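(* Let $(\Omega,\mathcal{A},\mathrm{P})$ be a complete probability space and $X=(X_t)_{t\in T}$ be a centered Gaussian process over $(\Omega,\mathcal{A},\mathrm{P})$ with RKHS $H_X$. Moreover, let $H$ be an RKHS on $T$ and $Y$ be a version of $X$ with $$\mathrm{P}(\{Y_\bullet\in H\})>0 .$$ Then, for all $\sigma$-algebras $\mathcal{B}$ on $T$ with $H_X\subset\mathcal{L}_0(\mathcal{B})$, all $\mathcal{B}$-measurable envelope functions $b:T\to[0,\infty)$ of $H$, and all measures $\nu$ on $(T,\mathcal{B})$ with $b\in\mathcal{L}_2(\nu)$, the operator $$I_{X,\nu}:H_X\to L_2(\nu),\qquad h\mapsto [h]_\sim,$$ is well-defined and nuclear.
   Context: $T$ is a non-empty set; all processes and functions are real-valued. An RKHS on $T$ is a reproducing kernel Hilbert space of functions $T\to\mathbb{R}$. For a centered Gaussian process $X=(X_t)_{t\in T}$ the covariance function is $k_X(s,t)=\mathbb{E}(X_sX_t)$, which is a reproducing kernel on $T$, and $H_X$ denotes the RKHS of $k_X$. Gaussian measures on $\mathbb{R}$ may be degenerate (point masses). A version $Y$ of $X$ is a process $Y=(Y_t)_{t\in T}$ on the same probability space with $\mathrm{P}(X_t=Y_t)=1$ for all $t\in T$. $Y_\bullet(\omega)$ denotes the path $t\mapsto Y_t(\omega)$, and $\{Y_\bullet\in H\}=\{\omega\in\Omega: Y_\bullet(\omega)\in H\}$. $\mathcal{L}_0(\mathcal{B})$ is the space of $\mathcal{B}$-measurable functions $T\to\mathbb{R}$; $\mathcal{L}_2(\nu)$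 is the space of $\mathcal B$-measurable square $\nu$-integrable functions and $L_2(\nu)$ the Hilbert space of their $\nu$-equivalence classes $[f]_\sim$. A function $b:T\to[0,\infty)$ is an envelope for an RKHS $H$ on $T$ if $|h(t)|\le\|h\|_H\, b(t)$ for all $h\in H$ and $t\in T$. *)

theory Defs
  imports "HOL-Probability.Probability"
begin

section \<open>Real Hilbert spaces on explicit carriers\<close>

text \<open>The spaces below depend on terms (a kernel, a measure), so they cannot be types of class
  real_inner. The operations are only meaningful on the carrier.\<close>

record 'v inner_space =
  vcarrier :: "'v set"
  vzero :: 'v
  vadd :: "'v \<Rightarrow> 'v \<Rightarrow> 'v"
  vscale :: "real \<Rightarrow> 'v \<Rightarrow> 'v"
  vinner :: "'v \<Rightarrow> 'v \<Rightarrow> real"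

definition vnorm :: "'v inner_space \<Rightarrow> 'v \<Rightarrow> real" where
  "vnorm V x = sqrt (vinner V x x)"

definition vdiff :: "'v inner_space \<Rightarrow> 'v \<Rightarrow> 'v \<Rightarrow> 'v" where
  "vdiff V x y = vadd V x (vscale V (-1) y)"

primrec vpartial_sum :: "'v inner_space \<Rightarrow> (nat \<Rightarrow> 'v) \<Rightarrow> nat \<Rightarrow> 'v" where
  "vpartial_sum V x 0 = vzero V"
| "vpartial_sum V x (Suc n) = vadd V (vpartial_sum V x n) (x n)"

definition vconverges :: "'v inner_space \<Rightarrow> (nat \<Rightarrow> 'v) \<Rightarrow> 'v \<Rightarrow> bool" where
  "vconverges V x l \<longleftrightarrow> (\<lambda>n. vnorm V (vdiff V (x n) l)) \<longlonglongrightarrow> 0"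

definition vCauchy :: "'v inner_space \<Rightarrow> (nat \<Rightarrow> 'v) \<Rightarrow> bool" where
  "vCauchy V x \<longleftrightarrow> (\<forall>e>0. \<exists>N. \<forall>m\<ge>N. \<forall>n\<ge>N. vnorm V (vdiff V (x m) (x n)) < e)"

locale vector_space_struct =
  fixes V :: "'v inner_space"
  assumes zero_closed: "vzero V \<in> vcarrier V"
    and add_closed: "\<lbrakk>x \<in> vcarrier V; y \<in> vcarrier V\<rbrakk> \<Longrightarrow> vadd V x y \<in> vcarrier V"
    and scale_closed: "x \<in> vcarrier V \<Longrightarrow> vscale V a x \<in> vcarrier V"
    and add_assoc: "\<lbrakk>x \<in> vcarrier V; y \<in> vcarrier V; z \<in> vcarrier V\<rbrakk> \<Longrightarrow>
          vadd V (vadd V x y) z = vadd V x (vadd V y z)"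
    and add_commute: "\<lbrakk>x \<in> vcarrier V; y \<in> vcarrier V\<rbrakk> \<Longrightarrow> vadd V x y = vadd V y x"
    and add_zero: "x \<in> vcarrier V \<Longrightarrow> vadd V x (vzero V) = x"
    and add_inverse: "x \<in> vcarrier V \<Longrightarrow> vadd V x (vscale V (-1) x) = vzero V"
    and scale_add_right: "\<lbrakk>x \<in> vcarrier V; y \<in> vcarrier V\<rbrakk> \<Longrightarrow>
          vscale V a (vadd V x y) = vadd V (vscale V a x) (vscale V a y)"
    and scale_add_left: "x \<in> vcarrier V \<Longrightarrow>
          vscale V (a + b) x = vadd V (vscale V a x) (vscale V b x)"
    and scale_scale: "x \<in> vcarrier V \<Longrightarrow> vscale V a (vscale V b x) = vscale V (a * b) x"
    and scale_one: "x \<in> vcarrier V \<Longrightarrow> vscale V 1 x = x"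

locale hilbert_struct = vector_space_struct V for V :: "'v inner_space" +
  assumes inner_commute: "\<lbrakk>x \<in> vcarrier V; y \<in> vcarrier V\<rbrakk> \<Longrightarrow> vinner V x y = vinner V y x"
    and inner_add_left: "\<lbrakk>x \<in> vcarrier V; y \<in> vcarrier V; z \<in> vcarrier V\<rbrakk> \<Longrightarrow>
          vinner V (vadd V x y) z = vinner V x z + vinner V y z"
    and inner_scale_left: "\<lbrakk>x \<in> vcarrier V; y \<in> vcarrier V\<rbrakk> \<Longrightarrow>
          vinner V (vscale V a x) y = a * vinner V x y"
    and inner_ge_zero: "x \<in> vcarrier V \<Longrightarrow> 0 \<le> vinner V x x"
    and inner_eq_zero_iff: "x \<in> vcarrier V \<Longrightarrow> vinner V x x = 0 \<longleftrightarrow> x = vzero V"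
    and complete: "\<And>x :: nat \<Rightarrow> 'v. \<lbrakk>range x \<subseteq> vcarrier V; vCauchy V x\<rbrakk> \<Longrightarrow>
          \<exists>l\<in>vcarrier V. vconverges V x l"

section \<open>Bounded functionals and nuclear operators\<close>

definition bounded_functional :: "'v inner_space \<Rightarrow> ('v \<Rightarrow> real) \<Rightarrow> bool" where
  "bounded_functional V \<phi> \<longleftrightarrow>
     (\<forall>x\<in>vcarrier V. \<forall>y\<in>vcarrier V. \<phi> (vadd V x y) = \<phi> x + \<phi> y) \<and>
     (\<forall>a. \<forall>x\<in>vcarrier V. \<phi> (vscale V a x) = a * \<phi> x) \<and>
     (\<exists>C. \<forall>x\<in>vcarrier V. \<bar>\<phi> x\<bar> \<le> C * vnorm V x)"

definition dual_norm :: "'v inner_space \<Rightarrow> ('v \<Rightarrow> real) \<Rightarrow> real" where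
  "dual_norm V \<phi> = (SUP x\<in>{x \<in> vcarrier V. vnorm V x \<le> 1}. \<bar>\<phi> x\<bar>)"

definition linear_operator :: "'v inner_space \<Rightarrow> 'w inner_space \<Rightarrow> ('v \<Rightarrow> 'w) \<Rightarrow> bool" where
  "linear_operator V W S \<longleftrightarrow>
     (\<forall>x\<in>vcarrier V. S x \<in> vcarrier W) \<and>
     (\<forall>x\<in>vcarrier V. \<forall>y\<in>vcarrier V. S (vadd V x y) = vadd W (S x) (S y)) \<and>
     (\<forall>a. \<forall>x\<in>vcarrier V. S (vscale V a x) = vscale W a (S x))"

text \<open>\<open>S x = (\<Sum>n. \<phi>\<^sub>n x w\<^sub>n)\<close> for all \<open>x\<close>, with \<open>(\<Sum>n. \<parallel>\<phi>\<^sub>n\<parallel> \<parallel>w\<^sub>n\<parallel>) < \<infinity>\<close>.\<close>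

definition nuclear_operator :: "'v inner_space \<Rightarrow> 'w inner_space \<Rightarrow> ('v \<Rightarrow> 'w) \<Rightarrow> bool" where
  "nuclear_operator V W S \<longleftrightarrow>
     linear_operator V W S \<and>
     (\<exists>(\<phi> :: nat \<Rightarrow> 'v \<Rightarrow> real) (w :: nat \<Rightarrow> 'w).
        (\<forall>n. bounded_functional V (\<phi> n)) \<and> (\<forall>n. w n \<in> vcarrier W) \<and>
        summable (\<lambda>n. dual_norm V (\<phi> n) * vnorm W (w n)) \<and>
        (\<forall>x\<in>vcarrier V. vconverges W (vpartial_sum W (\<lambda>n. vscale W (\<phi> n x) (w n))) (S x)))"

section \<open>Reproducing kernel Hilbert spaces\<close>

text \<open>The index set is the (automatically non-empty) type \<open>'t\<close>.\<close>

locale rkhs = hilbert_struct H for H :: "('t \<Rightarrow> real) inner_space" +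
  assumes add_pointwise: "\<lbrakk>f \<in> vcarrier H; g \<in> vcarrier H\<rbrakk> \<Longrightarrow> vadd H f g = (\<lambda>t. f t + g t)"
    and scale_pointwise: "f \<in> vcarrier H \<Longrightarrow> vscale H a f = (\<lambda>t. a * f t)"
    and bounded_evaluation: "bounded_functional H (\<lambda>f. f t)"

definition rkhs_of_kernel :: "('t \<Rightarrow> real) inner_space \<Rightarrow> ('t \<Rightarrow> 't \<Rightarrow> real) \<Rightarrow> bool" where
  "rkhs_of_kernel H k \<longleftrightarrow>
     rkhs H \<and> (\<forall>t. (\<lambda>s. k s t) \<in> vcarrier H) \<and>
     (\<forall>t. \<forall>h\<in>vcarrier H. h t = vinner H h (\<lambda>s. k s t))"

definition envelope :: "('t \<Rightarrow> real) inner_space \<Rightarrow> ('t \<Rightarrow> real) \<Rightarrow> bool" where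
  "envelope H b \<longleftrightarrow> (\<forall>t. 0 \<le> b t) \<and> (\<forall>h\<in>vcarrier H. \<forall>t. \<bar>h t\<bar> \<le> vnorm H h * b t)"

section \<open>Gaussian processes\<close>

text \<open>Point masses count as Gaussian.\<close>

definition gaussian_measure :: "real measure \<Rightarrow> bool" where
  "gaussian_measure \<mu> \<longleftrightarrow>
     (\<exists>m \<sigma>. 0 < \<sigma> \<and> \<mu> = density lborel (\<lambda>x. ennreal (normal_density m \<sigma> x))) \<or>
     (\<exists>m. \<mu> = return borel m)"

definition gaussian_process :: "'w measure \<Rightarrow> ('t \<Rightarrow> 'w \<Rightarrow> real) \<Rightarrow> bool" where
  "gaussian_process M X \<longleftrightarrow>
     (\<forall>t. X t \<in> borel_measurable M) \<and>
     (\<forall>F a. finite F \<longrightarrow> gaussian_measure (distr M borel (\<lambda>\<omega>. \<Sum>t\<in>F. a t * X t \<omega>)))"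

definition centered_gaussian_process :: "'w measure \<Rightarrow> ('t \<Rightarrow> 'w \<Rightarrow> real) \<Rightarrow> bool" where
  "centered_gaussian_process M X \<longleftrightarrow>
     gaussian_process M X \<and> (\<forall>t. (LINT \<omega>|M. X t \<omega>) = 0)"

definition covariance_kernel :: "'w measure \<Rightarrow> ('t \<Rightarrow> 'w \<Rightarrow> real) \<Rightarrow> 't \<Rightarrow> 't \<Rightarrow> real" where
  "covariance_kernel M X s t = (LINT \<omega>|M. X s \<omega> * X t \<omega>)"

definition version_of :: "'w measure \<Rightarrow> ('t \<Rightarrow> 'w \<Rightarrow> real) \<Rightarrow> ('t \<Rightarrow> 'w \<Rightarrow> real) \<Rightarrow> bool" where
  "version_of M X Y \<longleftrightarrow>
     (\<forall>t. Y t \<in> borel_measurable M) \<and> (\<forall>t. AE \<omega> in M. X t \<omega> = Y t \<omega>)"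

section \<open>The Hilbert space of classes of square integrable functions\<close>

definition L2_fun :: "'t measure \<Rightarrow> ('t \<Rightarrow> real) set" where
  "L2_fun \<nu> = {f \<in> borel_measurable \<nu>. integrable \<nu> (\<lambda>t. (f t)\<^sup>2)}"

definition L2_rel :: "'t measure \<Rightarrow> (('t \<Rightarrow> real) \<times> ('t \<Rightarrow> real)) set" where
  "L2_rel \<nu> = {(f, g). f \<in> L2_fun \<nu> \<and> g \<in> L2_fun \<nu> \<and> (AE t in \<nu>. f t = g t)}"

text \<open>For \<open>f\<close> outside \<open>L2_fun \<nu>\<close> the class is empty, and hence not an element of the quotient.\<close>

definition L2_class :: "'t measure \<Rightarrow> ('t \<Rightarrow> real) \<Rightarrow> ('t \<Rightarrow> real) set" where
  "L2_class \<nu> f = L2_rel \<nu> `` {f}"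

definition L2_rep :: "('t \<Rightarrow> real) set \<Rightarrow> 't \<Rightarrow> real" where
  "L2_rep A = (SOME f. f \<in> A)"

text \<open>Sums, multiples and inner products of classes are taken through representatives; on the carrier
  the choice does not matter.\<close>

definition L2_space :: "'t measure \<Rightarrow> ('t \<Rightarrow> real) set inner_space" where
  "L2_space \<nu> =
     \<lparr> vcarrier = L2_fun \<nu> // L2_rel \<nu>,
       vzero = L2_class \<nu> (\<lambda>t. 0),
       vadd = (\<lambda>A B. L2_class \<nu> (\<lambda>t. L2_rep A t + L2_rep B t)),
       vscale = (\<lambda>a A. L2_class \<nu> (\<lambda>t. a * L2_rep A t)),
       vinner = (\<lambda>A B. LINT t|\<nu>. L2_rep A t * L2_rep B t) \<rparr>"

end

theory Submission
  imports Defs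
begin

text \<open>
  The embedding of \<open>H\<^sub>X\<close> into \<open>L\<^sub>2(\<nu>)\<close> is nuclear because it factors through the closure \<open>S\<close> of \<open>H\<^sub>X\<close>
  in \<open>H\<close> as a product of two Hilbert-Schmidt maps. Let \<open>(e\<^sub>n)\<close> be a complete orthonormal sequence of
  \<open>S\<close>, padded with zeros if \<open>S\<close> has finite dimension. Then
  \<open>h = (\<Sum>n. \<langle>h, e\<^sub>n\<rangle>\<^sub>H e\<^sub>n)\<close> for all \<open>h\<close> in \<open>H\<^sub>X\<close>, with convergence in \<open>H\<close> and hence,
  by the envelope, in \<open>L\<^sub>2(\<nu>)\<close>. This is a nuclear representation with functionals
  \<open>\<phi>\<^sub>n = \<langle>\<cdot>, e\<^sub>n\<rangle>\<^sub>H\<close> on \<open>H\<^sub>X\<close> and vectors \<open>[e\<^sub>n]\<close>, provided that both \<open>(\<parallel>\<phi>\<^sub>n\<parallel>)\<close> and \<open>(\<parallel>[e\<^sub>n]\<parallel>)\<close> are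
  square summable. For the vectors this holds since \<open>(\<Sum>n. e\<^sub>n(t)\<^sup>2) \<le> b(t)\<^sup>2\<close>
  (\<open>envelope_sum_sq_le\<close>). For the functionals it is the probabilistic core of the argument,
  \<open>sum_dual_norm_sq_le\<close>.

  The idea there: some ball of radius \<open>r\<close> in \<open>H\<close> contains the paths of \<open>Y\<close> with positive outer
  probability \<open>q\<close> (the norm of the path need not be measurable, hence the outer probability). A finite
  combination \<open>g = (\<Sum>t. a\<^sub>t k\<^sub>H(\<cdot>, t))\<close> acts on paths in \<open>H\<close> as the Gaussian variable
  \<open>\<langle>Y, g\<rangle>\<^sub>H = (\<Sum>t. a\<^sub>t Y\<^sub>t)\<close>, and the norm of the functional \<open>\<langle>\<cdot>, g\<rangle>\<^sub>H\<close> on \<open>H\<^sub>X\<close> is at most the standard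
  deviation of this variable. A centered Gaussian variable that is bounded by \<open>c\<close> with probability at
  least \<open>q\<close> has standard deviation at most \<open>c / q\<close>; this yields \<open>H\<^sub>X \<subseteq> H\<close> with a continuous embedding.
  Likewise, the squared norm of a Gaussian vector with covariance matrix \<open>\<Sigma>\<close> has mean
  \<open>tr \<Sigma>\<close> and variance \<open>2 tr \<Sigma>\<^sup>2 \<le> 2 \<parallel>\<Sigma>\<parallel> tr \<Sigma>\<close>. If the trace is much larger than \<open>\<parallel>\<Sigma>\<parallel>\<close>, this squared
  norm concentrates around \<open>tr \<Sigma>\<close>, so that it can stay below a constant with probability at least
  \<open>q\<close> only if \<open>tr \<Sigma>\<close> is bounded (\<open>gaussian_trace_bound\<close>). Applied to the coordinates
  of the path along an orthonormal system, this bounds \<open>(\<Sum>n. \<parallel>\<phi>\<^sub>n\<parallel>\<^sup>2)\<close> uniformly over all finite orthonormal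
  systems. Since \<open>\<phi>\<^sub>n \<noteq> 0\<close> for unit vectors of \<open>S\<close>, it also shows that orthonormal systems
  of \<open>S\<close> are countable although \<open>H\<close> itself may be non-separable.
\<close>

section \<open>Geometry of a reproducing kernel Hilbert space\<close>

context rkhs
begin

lemma zero_pointwise: "vzero H = (\<lambda>t. 0)"
proof -
  have "vzero H = vadd H (vzero H) (vscale H (-1) (vzero H))"
    using add_inverse[OF zero_closed] by simp
  also have "\<dots> = (\<lambda>t. 0)"
    using scale_closed[OF zero_closed, of "-1"]
    by (simp add: add_pointwise scale_pointwise zero_closed)
  finally show ?thesis .
qed

lemma zero_fun_closed: "(\<lambda>t. 0) \<in> vcarrier H"
  using zero_closed zero_pointwise by simp

lemma add_fun_closed:
  "\<lbrakk>f \<in> vcarrier H; g \<in> vcarrier H\<rbrakk> \<Longrightarrow> (\<lambda>t. f t + g t) \<in> vcarrier H"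
  using add_closed add_pointwise by metis

lemma scale_fun_closed: "f \<in> vcarrier H \<Longrightarrow> (\<lambda>t. a * f t) \<in> vcarrier H"
  using scale_closed scale_pointwise by metis

lemma diff_fun_closed:
  assumes "f \<in> vcarrier H" "g \<in> vcarrier H"
  shows "(\<lambda>t. f t - g t) \<in> vcarrier H"
  using add_fun_closed[OF assms(1) scale_fun_closed[OF assms(2), of "-1"]] by simp

lemma sum_fun_closed:
  assumes "\<And>i. i \<in> I \<Longrightarrow> f i \<in> vcarrier H"
  shows "(\<lambda>t. \<Sum>i\<in>I. c i * f i t) \<in> vcarrier H"
  using assms
  by (induction I rule: infinite_finite_induct)
    (simp_all add: zero_fun_closed add_fun_closed scale_fun_closed)

lemma vdiff_pointwise:
  assumes "f \<in> vcarrier H" "g \<in> vcarrier H"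
  shows "vdiff H f g = (\<lambda>t. f t - g t)"
  using assms scale_fun_closed[OF assms(2), of "-1"]
  by (simp add: vdiff_def add_pointwise scale_pointwise)

lemma inner_add_fun:
  "\<lbrakk>f \<in> vcarrier H; g \<in> vcarrier H; h \<in> vcarrier H\<rbrakk> \<Longrightarrow>
    vinner H (\<lambda>t. f t + g t) h = vinner H f h + vinner H g h"
  using inner_add_left add_pointwise by metis

lemma inner_scale_fun:
  "\<lbrakk>f \<in> vcarrier H; h \<in> vcarrier H\<rbrakk> \<Longrightarrow> vinner H (\<lambda>t. a * f t) h = a * vinner H f h"
  using inner_scale_left scale_pointwise by metis

lemma inner_zero_fun: "h \<in> vcarrier H \<Longrightarrow> vinner H (\<lambda>t. 0) h = 0"
  using inner_scale_fun[OF zero_fun_closed, of h 0] by simp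

lemma inner_diff_fun:
  assumes "f \<in> vcarrier H" "g \<in> vcarrier H" "h \<in> vcarrier H"
  shows "vinner H (\<lambda>t. f t - g t) h = vinner H f h - vinner H g h"
  using inner_add_fun[OF assms(1) scale_fun_closed[OF assms(2), of "-1"] assms(3)]
    inner_scale_fun[OF assms(2,3), of "-1"] by simp

lemma inner_sum_fun:
  assumes "\<And>i. i \<in> I \<Longrightarrow> f i \<in> vcarrier H" "h \<in> vcarrier H"
  shows "vinner H (\<lambda>t. \<Sum>i\<in>I. c i * f i t) h = (\<Sum>i\<in>I. c i * vinner H (f i) h)"
  using assms
  by (induction I rule: infinite_finite_induct)
    (simp_all add: inner_zero_fun inner_add_fun inner_scale_fun scale_fun_closed sum_fun_closed)

lemma inner_sum_fun_right:
  assumes "\<And>i. i \<in> I \<Longrightarrow> f i \<in> vcarrier H" "h \<in> vcarrier H"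
  shows "vinner H h (\<lambda>t. \<Sum>i\<in>I. c i * f i t) = (\<Sum>i\<in>I. c i * vinner H h (f i))"
proof -
  have "vinner H h (\<lambda>t. \<Sum>i\<in>I. c i * f i t) = vinner H (\<lambda>t. \<Sum>i\<in>I. c i * f i t) h"
    by (rule inner_commute[OF assms(2) sum_fun_closed]) (rule assms(1))
  then show ?thesis
    using assms by (simp add: inner_sum_fun inner_commute[OF assms(2)])
qed

lemma inner_diff_fun_right:
  assumes "f \<in> vcarrier H" "g \<in> vcarrier H" "h \<in> vcarrier H"
  shows "vinner H h (\<lambda>t. f t - g t) = vinner H h f - vinner H h g"
  using inner_commute[OF assms(3) diff_fun_closed[OF assms(1,2)]] inner_diff_fun[OF assms]
    inner_commute[OF assms(1,3)] inner_commute[OF assms(2,3)] by simp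

lemma inner_add_fun_right:
  assumes "f \<in> vcarrier H" "g \<in> vcarrier H" "h \<in> vcarrier H"
  shows "vinner H h (\<lambda>t. f t + g t) = vinner H h f + vinner H h g"
  using inner_commute[OF assms(3) add_fun_closed[OF assms(1,2)]] inner_add_fun[OF assms]
    inner_commute[OF assms(1,3)] inner_commute[OF assms(2,3)] by simp

lemma inner_scale_fun_right:
  assumes "f \<in> vcarrier H" "h \<in> vcarrier H"
  shows "vinner H h (\<lambda>t. a * f t) = a * vinner H h f"
  using inner_commute[OF assms(2) scale_fun_closed[OF assms(1), of a]] inner_scale_fun[OF assms]
    inner_commute[OF assms] by simp

lemma norm_sq: "f \<in> vcarrier H \<Longrightarrow> (vnorm H f)\<^sup>2 = vinner H f f"
  by (simp add: vnorm_def inner_ge_zero)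

lemma norm_nonneg: "f \<in> vcarrier H \<Longrightarrow> 0 \<le> vnorm H f"
  by (simp add: vnorm_def inner_ge_zero)

lemma norm_zero_fun: "vnorm H (\<lambda>t. 0) = 0"
  by (simp add: vnorm_def inner_zero_fun zero_fun_closed)

lemma norm_eq_zero_fun: "f \<in> vcarrier H \<Longrightarrow> vinner H f f = 0 \<Longrightarrow> f = (\<lambda>t. 0)"
  using inner_eq_zero_iff zero_pointwise by metis

lemma norm_scale_fun:
  assumes "f \<in> vcarrier H" shows "vnorm H (\<lambda>t. a * f t) = \<bar>a\<bar> * vnorm H f"
proof -
  have "vinner H (\<lambda>t. a * f t) (\<lambda>t. a * f t) = a * (a * vinner H f f)"
    using assms by (simp add: inner_scale_fun scale_fun_closed inner_scale_fun_right)
  then show ?thesis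
    by (simp add: vnorm_def real_sqrt_mult flip: mult.assoc)
qed

lemma norm_sq_add_scaled:
  assumes "f \<in> vcarrier H" "g \<in> vcarrier H"
  shows "vinner H (\<lambda>t. f t + a * g t) (\<lambda>t. f t + a * g t) =
     vinner H f f + 2 * a * vinner H f g + a\<^sup>2 * vinner H g g"
proof -
  note ag = scale_fun_closed[OF assms(2), of a]
  show ?thesis
    using assms ag
    by (simp add: inner_add_fun inner_add_fun_right inner_scale_fun_right inner_commute[of g f]
       add_fun_closed inner_scale_fun power2_eq_square algebra_simps)
qed

lemma cauchy_schwarz:
  assumes "f \<in> vcarrier H" "g \<in> vcarrier H"
  shows "\<bar>vinner H f g\<bar> \<le> vnorm H f * vnorm H g"
proof -
  let ?a = "vinner H f f" and ?b = "vinner H f g" and ?c = "vinner H g g"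
  have quad: "0 \<le> ?a + 2 * x * ?b + x\<^sup>2 * ?c" for x
    using norm_sq_add_scaled[OF assms, of x] inner_ge_zero[OF add_fun_closed[OF assms(1)
      scale_fun_closed[OF assms(2), of x]]] by simp
  have "?b\<^sup>2 \<le> ?a * ?c"
  proof (cases "?c = 0")
    case True
    then have "g = (\<lambda>t. 0)" using norm_eq_zero_fun assms by blast
    then have "?b = 0" using inner_zero_fun assms inner_commute by metis
    then show ?thesis using True by simp
  next
    case False
    then have c: "?c > 0" using inner_ge_zero[OF assms(2)] by simp
    have "0 \<le> ?a + 2 * (- ?b / ?c) * ?b + (- ?b / ?c)\<^sup>2 * ?c" by (rule quad)
    also have "\<dots> = ?a - ?b\<^sup>2 / ?c" using c by (simp add: field_simps power2_eq_square)
    finally show ?thesis using c by (simp add: field_simps)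
  qed
  then have "sqrt (?b\<^sup>2) \<le> sqrt (?a * ?c)" by (rule real_sqrt_le_mono)
  then show ?thesis by (simp add: vnorm_def real_sqrt_mult)
qed

lemma norm_triangle:
  assumes "f \<in> vcarrier H" "g \<in> vcarrier H"
  shows "vnorm H (\<lambda>t. f t + g t) \<le> vnorm H f + vnorm H g"
proof (rule power2_le_imp_le)
  have "(vnorm H (\<lambda>t. f t + g t))\<^sup>2 = vinner H f f + 2 * vinner H f g + vinner H g g"
    using norm_sq_add_scaled[OF assms, of 1] assms by (simp add: norm_sq add_fun_closed)
  also have "\<dots> \<le> (vnorm H f + vnorm H g)\<^sup>2"
    using cauchy_schwarz[OF assms] assms by (simp add: power2_sum norm_sq)
  finally show "(vnorm H (\<lambda>t. f t + g t))\<^sup>2 \<le> (vnorm H f + vnorm H g)\<^sup>2" .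
qed (use assms norm_nonneg in auto)

lemma norm_sum_le:
  assumes "\<And>i. i \<in> I \<Longrightarrow> f i \<in> vcarrier H"
  shows "vnorm H (\<lambda>t. \<Sum>i\<in>I. c i * f i t) \<le> (\<Sum>i\<in>I. \<bar>c i\<bar> * vnorm H (f i))"
  using assms
proof (induction I rule: infinite_finite_induct)
  case (insert i I)
  have "vnorm H (\<lambda>t. c i * f i t + (\<Sum>i\<in>I. c i * f i t))
      \<le> vnorm H (\<lambda>t. c i * f i t) + vnorm H (\<lambda>t. \<Sum>i\<in>I. c i * f i t)"
    using insert.prems by (intro norm_triangle scale_fun_closed sum_fun_closed) auto
  then show ?case using insert by (simp add: norm_scale_fun)
qed (simp_all add: norm_zero_fun)

lemma norm_diff_commute:
  assumes "f \<in> vcarrier H" "g \<in> vcarrier H"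
  shows "vnorm H (\<lambda>t. f t - g t) = vnorm H (\<lambda>t. g t - f t)"
  using norm_scale_fun[OF diff_fun_closed[OF assms], of "-1"] by simp

lemma evaluation_bound: "\<exists>C. \<forall>f\<in>vcarrier H. \<bar>f t\<bar> \<le> C * vnorm H f"
  using bounded_evaluation[of t] by (simp add: bounded_functional_def)

lemma converges_pointwise:
  assumes "\<And>n. x n \<in> vcarrier H" "l \<in> vcarrier H"
    and "(\<lambda>n. vnorm H (\<lambda>t. x n t - l t)) \<longlonglongrightarrow> 0"
  shows "(\<lambda>n. x n t) \<longlonglongrightarrow> l t"
proof -
  obtain C where C: "\<And>f. f \<in> vcarrier H \<Longrightarrow> \<bar>f t\<bar> \<le> C * vnorm H f"
    using evaluation_bound by blast
  have "(\<lambda>n. x n t - l t) \<longlonglongrightarrow> 0"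
  proof (rule Lim_null_comparison)
    show "\<forall>\<^sub>F n in sequentially. norm (x n t - l t) \<le> C * vnorm H (\<lambda>t. x n t - l t)"
      using C[OF diff_fun_closed[OF assms(1,2)]] by simp
    show "(\<lambda>n. C * vnorm H (\<lambda>t. x n t - l t)) \<longlonglongrightarrow> 0"
      using tendsto_mult_left[OF assms(3), of C] by simp
  qed
  then show ?thesis by (simp add: LIM_zero_iff)
qed

lemma converges_inner:
  assumes "\<And>n. x n \<in> vcarrier H" "l \<in> vcarrier H" "f \<in> vcarrier H"
    and "(\<lambda>n. vnorm H (\<lambda>t. x n t - l t)) \<longlonglongrightarrow> 0"
  shows "(\<lambda>n. vinner H (x n) f) \<longlonglongrightarrow> vinner H l f"
proof -
  have "(\<lambda>n. vinner H (x n) f - vinner H l f) \<longlonglongrightarrow> 0"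
  proof (rule Lim_null_comparison)
    show "\<forall>\<^sub>F n in sequentially. norm (vinner H (x n) f - vinner H l f)
        \<le> vnorm H (\<lambda>t. x n t - l t) * vnorm H f"
      using cauchy_schwarz[OF diff_fun_closed[OF assms(1,2)] assms(3)] assms
      by (simp add: inner_diff_fun)
    show "(\<lambda>n. vnorm H (\<lambda>t. x n t - l t) * vnorm H f) \<longlonglongrightarrow> 0"
      using tendsto_mult_right[OF assms(4)] by simp
  qed
  then show ?thesis by (simp add: LIM_zero_iff)
qed

lemma cauchy_converges:
  assumes x: "\<And>n. x n \<in> vcarrier H"
    and "\<And>e. e > 0 \<Longrightarrow> \<exists>N. \<forall>m\<ge>N. \<forall>n\<ge>N. vnorm H (\<lambda>t. x m t - x n t) < e"
  obtains l where "l \<in> vcarrier H" "(\<lambda>n. vnorm H (\<lambda>t. x n t - l t)) \<longlonglongrightarrow> 0"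
proof -
  have "vCauchy H x" using assms by (simp add: vCauchy_def vdiff_pointwise)
  then obtain l where "l \<in> vcarrier H" "vconverges H x l" using complete x by blast
  then show thesis using that x by (simp add: vconverges_def vdiff_pointwise)
qed

text \<open>A common form of the Riesz representation theorem and of orthogonal projection: a bounded linear
  functional on a subspace has a representer that is a limit of elements of this subspace. The
  functional is given by its graph \<open>R\<close>, which makes its well-definedness a consequence of the
  bound; this matters where the elements of the subspace are linear combinations whose coefficients
  are not unique. The representer is the limit of a minimising sequence
  of \<open>\<parallel>f\<parallel>\<^sup>2 - 2 s\<close> over \<open>(f, s) \<in> R\<close>.\<close>

lemma riesz_relation:
  assumes R: "\<And>f r. (f, r) \<in> R \<Longrightarrow> f \<in> vcarrier H"
    and zero: "(\<lambda>t. 0, 0) \<in> R"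
    and lin: "\<And>f r g s a. (f, r) \<in> R \<Longrightarrow> (g, s) \<in> R \<Longrightarrow> (\<lambda>t. f t + a * g t, r + a * s) \<in> R"
    and bound: "\<And>f r. (f, r) \<in> R \<Longrightarrow> \<bar>r\<bar> \<le> c * vnorm H f"
    and c: "0 \<le> c"
  obtains v x where "v \<in> vcarrier H" "\<And>n. x n \<in> Domain R"
    "(\<lambda>n. vnorm H (\<lambda>t. x n t - v t)) \<longlonglongrightarrow> 0"
    "\<And>f r. (f, r) \<in> R \<Longrightarrow> vinner H v f = r" "vnorm H v \<le> c"
proof -
  define J where "J = (\<lambda>(f, r). vinner H f f - 2 * r)"
  have J_lower: "- c\<^sup>2 \<le> J p" if "p \<in> R" for p
  proof -
    obtain f r where p: "p = (f, r)" by (cases p)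
    have "0 \<le> (vnorm H f - c)\<^sup>2" by simp
    also have "\<dots> = vinner H f f - 2 * (c * vnorm H f) + c\<^sup>2"
      using R that p by (auto simp: power2_diff norm_sq)
    finally show ?thesis using bound[of f r] that p by (simp add: J_def)
  qed
  define m where "m = (INF p\<in>R. J p)"
  have bdd: "bdd_below (J ` R)" using J_lower by (auto intro!: bdd_belowI)
  have m_le: "m \<le> J p" if "p \<in> R" for p
    unfolding m_def by (rule cINF_lower[OF bdd that])
  have "\<exists>p\<in>R. J p < m + 1 / Suc n" for n
    using cINF_less_iff[OF _ bdd, of "m + 1 / Suc n"] zero unfolding m_def by force
  then obtain P where P: "\<And>n. P n \<in> R" "\<And>n. J (P n) < m + 1 / Suc n" by metis
  define x where "x n = fst (P n)" for n
  define s where "s n = snd (P n)" for n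
  have Pxs: "P n = (x n, s n)" for n by (simp add: x_def s_def)
  have x: "x n \<in> vcarrier H" for n using R P Pxs by metis
  have J_line: "J (\<lambda>t. x n t + a * f t, s n + a * r) =
      J (P n) + 2 * a * (vinner H (x n) f - r) + a\<^sup>2 * vinner H f f"
    if "(f, r) \<in> R" for n a f r
    using norm_sq_add_scaled[OF x R[OF that], of n a] by (simp add: J_def Pxs algebra_simps)
  \<comment> \<open>Since \<open>J\<close> is at least \<open>m\<close> at the midpoint, the parallelogram identity makes minimising sequences Cauchy.\<close>
  have near: "(vnorm H (\<lambda>t. x i t - x j t))\<^sup>2 < 2 / Suc i + 2 / Suc j" for i j
  proof -
    have d: "(vnorm H (\<lambda>t. x i t - x j t))\<^sup>2 =
        vinner H (x i) (x i) - 2 * vinner H (x i) (x j) + vinner H (x j) (x j)"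
      using norm_sq_add_scaled[OF x x, of i "-1" j] x by (simp add: norm_sq diff_fun_closed)
    let ?y = "\<lambda>t. x i t + 1 * x j t"
    have y: "(?y, s i + 1 * s j) \<in> R" using lin P Pxs by metis
    have "(\<lambda>t. 0 + (1/2) * ?y t, 0 + (1/2) * (s i + 1 * s j)) \<in> R" by (rule lin[OF zero y])
    then have "m \<le> J (\<lambda>t. (1/2) * ?y t, (1/2) * (s i + 1 * s j))" using m_le by simp
    also have "\<dots> = (1/4) * vinner H ?y ?y - (s i + s j)"
    proof -
      have "A - 2 * ((1/2) * (a + 1 * b)) = (1/4) * B - (a + b)"
        if "A = (1/2) * C" "C = (1/2) * B" for A B C a b :: real
        using that by (simp add: field_simps)
      then show ?thesis
        unfolding J_def prod.case
        using inner_scale_fun[OF R[OF y] scale_fun_closed[OF R[OF y], of "1/2"], of "1/2"]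
          inner_scale_fun_right[OF R[OF y] R[OF y], of "1/2"] by blast
    qed
    finally have "m \<le> (1/4) * vinner H ?y ?y - (s i + s j)" .
    moreover have "vinner H ?y ?y =
        vinner H (x i) (x i) + 2 * vinner H (x i) (x j) + vinner H (x j) (x j)"
      using norm_sq_add_scaled[OF x x, of i 1 j] by simp
    moreover have "vinner H (x i) (x i) - 2 * s i < m + 1 / Suc i"
      "vinner H (x j) (x j) - 2 * s j < m + 1 / Suc j"
      using P(2)[of i] P(2)[of j] by (simp_all add: J_def Pxs)
    ultimately show ?thesis unfolding d by (simp add: algebra_simps)
  qed
  obtain v where v: "v \<in> vcarrier H" "(\<lambda>n. vnorm H (\<lambda>t. x n t - v t)) \<longlonglongrightarrow> 0"
  proof (rule cauchy_converges[OF x])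
    fix e :: real assume e: "e > 0"
    obtain N where N: "N > 0" "inverse (real N) < e\<^sup>2 / 4"
      using ex_inverse_of_nat_less[of "e\<^sup>2 / 4"] e by auto
    have "vnorm H (\<lambda>t. x i t - x j t) < e" if "i \<ge> N" "j \<ge> N" for i j
    proof (rule power2_less_imp_less)
      have "2 / Suc i \<le> 2 * inverse (real N)" "2 / Suc j \<le> 2 * inverse (real N)"
        using that N(1) by (auto simp: field_simps)
      then show "(vnorm H (\<lambda>t. x i t - x j t))\<^sup>2 < e\<^sup>2" using near[of i j] N(2) by linarith
    qed (use e in simp)
    then show "\<exists>N. \<forall>m\<ge>N. \<forall>n\<ge>N. vnorm H (\<lambda>t. x m t - x n t) < e" by blast
  qed
  have "vinner H v f = r" if fr: "(f, r) \<in> R" for f r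
  proof -
    define d where "d = vinner H v f - r"
    \<comment> \<open>The minimality of \<open>v\<close> in the direction \<open>a * f\<close>, obtained as a limit along the minimising sequence.\<close>
    have quad: "0 \<le> 2 * a * d + a\<^sup>2 * vinner H f f" for a
    proof (rule LIMSEQ_le)
      show "(\<lambda>n. - (1 / real (Suc n))) \<longlonglongrightarrow> 0"
        using tendsto_minus[OF LIMSEQ_inverse_real_of_nat] by (simp add: inverse_eq_divide)
      show "(\<lambda>n. 2 * a * (vinner H (x n) f - r) + a\<^sup>2 * vinner H f f)
          \<longlonglongrightarrow> 2 * a * d + a\<^sup>2 * vinner H f f"
        unfolding d_def by (intro tendsto_intros converges_inner x v R[OF fr])
      have "- (1 / real (Suc n)) \<le> 2 * a * (vinner H (x n) f - r) + a\<^sup>2 * vinner H f f" for n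
        using m_le[OF lin[OF _ fr, of "x n" "s n" a]] P[of n] J_line[OF fr, of n a]
        by (simp add: Pxs)
      then show "\<exists>N. \<forall>n\<ge>N. - (1 / real (Suc n))
          \<le> 2 * a * (vinner H (x n) f - r) + a\<^sup>2 * vinner H f f" by blast
    qed
    define q where "q = vinner H f f + 1"
    have q: "0 < q" "vinner H f f \<le> q"
      using inner_ge_zero R fr by (force simp: q_def)+
    have "0 \<le> 2 * (- d / q) * d + (- d / q)\<^sup>2 * vinner H f f" by (rule quad)
    also have "\<dots> \<le> 2 * (- d / q) * d + (- d / q)\<^sup>2 * q"
      using q by (intro add_left_mono mult_left_mono) auto
    also have "\<dots> = - d\<^sup>2 / q" using q(1) by (simp add: field_simps power2_eq_square)
    finally have "d\<^sup>2 \<le> 0" using q(1) by (simp add: field_simps)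
    then show ?thesis by (simp add: d_def)
  qed
  note represents = this
  have "vnorm H v \<le> c"
  proof (rule ccontr)
    assume "\<not> vnorm H v \<le> c"
    then have pos: "0 < vnorm H v" "c < vnorm H v" using c by auto
    have "(\<lambda>n. vinner H (x n) v) \<longlonglongrightarrow> vinner H v v"
      by (rule converges_inner[OF x v(1) v(1) v(2)])
    moreover have "(\<lambda>n. c * (vnorm H (\<lambda>t. x n t - v t) + vnorm H v)) \<longlonglongrightarrow> c * (0 + vnorm H v)"
      by (intro tendsto_intros v)
    moreover have "vinner H (x n) v \<le> c * (vnorm H (\<lambda>t. x n t - v t) + vnorm H v)" for n
    proof -
      have xs: "(x n, s n) \<in> R" using P Pxs by metis
      have "vinner H (x n) v = s n"
        using represents[OF xs] inner_commute[OF x v(1)] by simp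
      also have "\<dots> \<le> c * vnorm H (x n)" using bound[OF xs] by simp
      also have "\<dots> \<le> c * (vnorm H (\<lambda>t. x n t - v t) + vnorm H v)"
        using norm_triangle[OF diff_fun_closed[OF x v(1)] v(1), of n] c
        by (intro mult_left_mono) auto
      finally show ?thesis .
    qed
    ultimately have "vinner H v v \<le> c * (0 + vnorm H v)"
      by (intro LIMSEQ_le) auto
    then show False
      using mult_strict_right_mono[OF pos(2,1)] norm_sq[OF v(1)] by (simp add: power2_eq_square)
  qed
  moreover have "x n \<in> Domain R" for n using P Pxs by (metis DomainI)
  ultimately show thesis using that v represents by blast
qed

lemma evaluation_representer:
  "\<exists>k\<in>vcarrier H. \<forall>f\<in>vcarrier H. vinner H f k = f t"
proof -
  obtain C where C: "\<And>f. f \<in> vcarrier H \<Longrightarrow> \<bar>f t\<bar> \<le> C * vnorm H f"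
    using evaluation_bound by blast
  define R where "R = {(f, r). f \<in> vcarrier H \<and> r = f t}"
  have bnd: "\<bar>f t\<bar> \<le> \<bar>C\<bar> * vnorm H f" if "f \<in> vcarrier H" for f
    by (rule order_trans[OF C[OF that]]) (simp add: mult_right_mono norm_nonneg that)
  obtain v where "v \<in> vcarrier H" "\<And>f r. (f, r) \<in> R \<Longrightarrow> vinner H v f = r"
    by (rule riesz_relation[of R "\<bar>C\<bar>"])
      (auto simp: R_def zero_fun_closed add_fun_closed scale_fun_closed intro: bnd)
  then show ?thesis unfolding R_def by (metis (mono_tags, lifting) case_prodI inner_commute mem_Collect_eq)
qed

end

section \<open>Dual norms\<close>

lemma dual_norm_le:
  assumes "rkhs V" and le: "\<And>x. x \<in> vcarrier V \<Longrightarrow> \<bar>\<phi> x\<bar> \<le> c * vnorm V x" and "0 \<le> c"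
  shows "dual_norm V \<phi> \<le> c"
proof -
  interpret V: rkhs V by fact
  show ?thesis unfolding dual_norm_def
  proof (rule cSUP_least)
    show "{x \<in> vcarrier V. vnorm V x \<le> 1} \<noteq> {}"
      using V.zero_fun_closed V.norm_zero_fun by fastforce
    fix x assume "x \<in> {x \<in> vcarrier V. vnorm V x \<le> 1}"
    then show "\<bar>\<phi> x\<bar> \<le> c"
      using le[of x] mult_left_mono[of "vnorm V x" 1 c] \<open>0 \<le> c\<close> by auto
  qed
qed

lemma le_dual_norm:
  assumes "rkhs V" and \<phi>: "bounded_functional V \<phi>" and x: "x \<in> vcarrier V" "vnorm V x \<le> 1"
  shows "\<bar>\<phi> x\<bar> \<le> dual_norm V \<phi>"
  unfolding dual_norm_def
proof (rule cSUP_upper)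
  interpret V: rkhs V by fact
  obtain C where C: "\<forall>x\<in>vcarrier V. \<bar>\<phi> x\<bar> \<le> C * vnorm V x"
    using \<phi> unfolding bounded_functional_def by blast
  show "bdd_above ((\<lambda>x. \<bar>\<phi> x\<bar>) ` {x \<in> vcarrier V. vnorm V x \<le> 1})"
  proof (rule bdd_aboveI2)
    fix x assume "x \<in> {x \<in> vcarrier V. vnorm V x \<le> 1}"
    then have "\<bar>\<phi> x\<bar> \<le> C * vnorm V x" "0 \<le> vnorm V x" "vnorm V x \<le> 1"
      using C V.norm_nonneg by auto
    then show "\<bar>\<phi> x\<bar> \<le> \<bar>C\<bar>"
      by (smt (verit) mult_left_le mult_right_mono abs_ge_self)
  qed
qed (use x in auto)

lemma dual_norm_nonneg:
  assumes "rkhs V" "bounded_functional V \<phi>"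
  shows "0 \<le> dual_norm V \<phi>"
proof -
  interpret V: rkhs V by fact
  have "\<bar>\<phi> (\<lambda>t. 0)\<bar> \<le> dual_norm V \<phi>"
    by (rule le_dual_norm[OF assms]) (simp_all add: V.zero_fun_closed V.norm_zero_fun)
  then show ?thesis by linarith
qed

lemma dual_norm_eq_zeroD:
  assumes "rkhs V" "bounded_functional V \<phi>" "dual_norm V \<phi> = 0" "x \<in> vcarrier V"
  shows "\<phi> x = 0"
proof -
  interpret V: rkhs V by fact
  define n where "n = vnorm V x + 1"
  have n: "n > 0" using V.norm_nonneg[OF assms(4)] by (simp add: n_def)
  have "vnorm V (\<lambda>t. (1 / n) * x t) = (1 / n) * vnorm V x"
    using n V.norm_scale_fun[OF assms(4), of "1 / n"] by simp
  also have "\<dots> \<le> 1" using n by (simp add: n_def)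
  finally have "\<bar>\<phi> (\<lambda>t. (1 / n) * x t)\<bar> \<le> 0"
    using le_dual_norm[OF assms(1,2) V.scale_fun_closed[OF assms(4)], of "1 / n"] assms(3) by simp
  moreover have "\<phi> (\<lambda>t. (1 / n) * x t) = (1 / n) * \<phi> x"
    using assms(2,4) V.scale_pointwise[OF assms(4), of "1 / n"]
    unfolding bounded_functional_def by metis
  ultimately show ?thesis using n by simp
qed

section \<open>Combinations of kernel sections\<close>

lemma sum_restrict_to_subset:
  fixes a z :: "'a \<Rightarrow> real"
  assumes "finite G" "F \<subseteq> G"
  shows "(\<Sum>t\<in>G. (if t \<in> F then a t else 0) * z t) = (\<Sum>t\<in>F. a t * z t)"
  using assms by (intro sum.mono_neutral_cong_right) auto

context rkhs
begin

text \<open>The section \<open>k\<^sub>H(\<cdot>, t)\<close> of the reproducing kernel of \<open>H\<close>.\<close>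

definition kernel_section :: "'t \<Rightarrow> 't \<Rightarrow> real" where
  "kernel_section t = (SOME k. k \<in> vcarrier H \<and> (\<forall>f\<in>vcarrier H. vinner H f k = f t))"

lemma kernel_section:
  "kernel_section t \<in> vcarrier H"
  "f \<in> vcarrier H \<Longrightarrow> vinner H f (kernel_section t) = f t"
proof -
  have "\<exists>k. k \<in> vcarrier H \<and> (\<forall>f\<in>vcarrier H. vinner H f k = f t)"
    using evaluation_representer[of t] by blast
  then have "kernel_section t \<in> vcarrier H \<and> (\<forall>f\<in>vcarrier H. vinner H f (kernel_section t) = f t)"
    unfolding kernel_section_def by (rule someI_ex)
  then show "kernel_section t \<in> vcarrier H"
    "f \<in> vcarrier H \<Longrightarrow> vinner H f (kernel_section t) = f t" by auto
qed

definition kernel_comb :: "'t set \<Rightarrow> ('t \<Rightarrow> real) \<Rightarrow> 't \<Rightarrow> real" where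
  "kernel_comb F a = (\<lambda>s. \<Sum>t\<in>F. a t * kernel_section t s)"

lemma kernel_comb_closed: "kernel_comb F a \<in> vcarrier H"
  unfolding kernel_comb_def by (intro sum_fun_closed kernel_section)

lemma inner_kernel_comb:
  "f \<in> vcarrier H \<Longrightarrow> vinner H f (kernel_comb F a) = (\<Sum>t\<in>F. a t * f t)"
  unfolding kernel_comb_def by (subst inner_sum_fun_right) (simp_all add: kernel_section)

lemma kernel_comb_add:
  assumes "finite F" "finite G"
  shows "\<exists>c. (\<lambda>s. kernel_comb F a s + x * kernel_comb G b s) = kernel_comb (F \<union> G) c
    \<and> (\<forall>z. (\<Sum>t\<in>F. a t * z t) + x * (\<Sum>t\<in>G. b t * z t) = (\<Sum>t\<in>F \<union> G. c t * z t))"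
proof -
  define c where "c t = (if t \<in> F then a t else 0) + x * (if t \<in> G then b t else 0)" for t
  have *: "(\<Sum>t\<in>F. a t * z t) + x * (\<Sum>t\<in>G. b t * z t) = (\<Sum>t\<in>F \<union> G. c t * z t)" for z
    using sum_restrict_to_subset[of "F \<union> G" F a z] sum_restrict_to_subset[of "F \<union> G" G b z] assms
    unfolding c_def distrib_right sum.distrib by (simp add: mult.assoc flip: sum_distrib_left)
  show ?thesis unfolding kernel_comb_def by (intro exI[of _ c]) (simp add: *)
qed

text \<open>The projection of \<open>f\<close> to the closure of the combinations has the same inner product with every
  kernel section as \<open>f\<close>, that is, the same values; so it is \<open>f\<close>.\<close>

lemma kernel_comb_dense:
  assumes f: "f \<in> vcarrier H" and e: "0 < e"
  obtains F a where "finite F" "vnorm H (\<lambda>t. kernel_comb F a t - f t) < e"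
proof -
  define R where "R = {(kernel_comb F a, vinner H f (kernel_comb F a)) | F a. finite F}"
  obtain v x where v: "v \<in> vcarrier H" "\<And>n. x n \<in> Domain R"
    "(\<lambda>n. vnorm H (\<lambda>t. x n t - v t)) \<longlonglongrightarrow> 0"
    "\<And>g r. (g, r) \<in> R \<Longrightarrow> vinner H v g = r"
  proof (rule riesz_relation[of R "vnorm H f"])
    have "(kernel_comb {} (\<lambda>t. 0), vinner H f (kernel_comb {} (\<lambda>t. 0))) \<in> R"
      unfolding R_def by blast
    then show "(\<lambda>t. 0, 0) \<in> R" using f by (simp add: inner_kernel_comb) (simp add: kernel_comb_def)
    show "(\<lambda>t. g t + a * h t, r + a * s) \<in> R" if "(g, r) \<in> R" "(h, s) \<in> R" for g r h s a
    proof -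
      obtain F b where F: "finite F" "g = kernel_comb F b" "r = vinner H f g"
        using \<open>(g, r) \<in> R\<close> unfolding R_def by blast
      obtain G c where G: "finite G" "h = kernel_comb G c" "s = vinner H f h"
        using \<open>(h, s) \<in> R\<close> unfolding R_def by blast
      obtain d where d: "(\<lambda>s. kernel_comb F b s + a * kernel_comb G c s) = kernel_comb (F \<union> G) d"
        "\<And>z. (\<Sum>t\<in>F. b t * z t) + a * (\<Sum>t\<in>G. c t * z t) = (\<Sum>t\<in>F \<union> G. d t * z t)"
        using kernel_comb_add[OF F(1) G(1), of b a c] by blast
      have "r + a * s = vinner H f (kernel_comb (F \<union> G) d)"
        using d(2)[of f] f F G by (simp add: inner_kernel_comb)
      then have "(\<lambda>t. g t + a * h t, r + a * s) =
          (kernel_comb (F \<union> G) d, vinner H f (kernel_comb (F \<union> G) d))"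
        using d(1) F G by simp
      then show ?thesis using F(1) G(1) unfolding R_def by blast
    qed
  qed (use f in \<open>auto simp: R_def kernel_comb_closed norm_nonneg intro: cauchy_schwarz\<close>)
  have "v = f"
  proof
    fix t
    have "(kernel_comb {t} (\<lambda>_. 1), vinner H f (kernel_comb {t} (\<lambda>_. 1))) \<in> R"
      unfolding R_def by blast
    from v(4)[OF this] show "v t = f t" using f v(1) by (simp add: inner_kernel_comb)
  qed
  moreover obtain n where "vnorm H (\<lambda>t. x n t - v t) < e"
    using order_tendstoD(2)[OF v(3) e] by (auto simp: eventually_sequentially)
  moreover obtain F a where "finite F" "x n = kernel_comb F a"
    using v(2)[of n] by (auto simp: R_def)
  ultimately show thesis using that by metis
qed

text \<open>The map \<open>c \<mapsto> (\<Sum>j. c\<^sub>j g\<^sub>j)\<close> and its adjoint \<open>y \<mapsto> (\<langle>y, g\<^sub>j\<rangle>)\<^sub>j\<close> have the same norm.\<close>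

lemma dual_of_coefficient_bound:
  assumes "finite J" and g: "\<And>j. j \<in> J \<Longrightarrow> g j \<in> vcarrier H" and y: "y \<in> vcarrier H"
    and bound: "\<And>c. vnorm H (\<lambda>t. \<Sum>j\<in>J. c j * g j t) \<le> B * sqrt (\<Sum>j\<in>J. (c j)\<^sup>2)"
  shows "(\<Sum>j\<in>J. (vinner H y (g j))\<^sup>2) \<le> B\<^sup>2 * (vnorm H y)\<^sup>2"
proof -
  define c where "c j = vinner H y (g j)" for j
  define S where "S = (\<Sum>j\<in>J. (c j)\<^sup>2)"
  have S: "0 \<le> S" by (simp add: S_def sum_nonneg)
  have "S = vinner H y (\<lambda>t. \<Sum>j\<in>J. c j * g j t)"
    using g y by (subst inner_sum_fun_right) (auto simp: S_def c_def power2_eq_square)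
  also have "\<dots> \<le> vnorm H y * vnorm H (\<lambda>t. \<Sum>j\<in>J. c j * g j t)"
    using cauchy_schwarz[OF y sum_fun_closed[of J g c]] g by fastforce
  also have "\<dots> \<le> vnorm H y * (B * sqrt S)"
    unfolding S_def by (intro mult_left_mono bound norm_nonneg y)
  finally have *: "S \<le> (B * vnorm H y) * sqrt S" by (simp add: mult_ac)
  have "S \<le> (B * vnorm H y)\<^sup>2"
  proof (cases "S = 0")
    case False
    then have pos: "0 < sqrt S" using S by simp
    have "sqrt S * sqrt S \<le> (B * vnorm H y) * sqrt S" using * S by simp
    then have "sqrt S \<le> B * vnorm H y" by (rule mult_right_le_imp_le[OF _ pos])
    then have "(sqrt S)\<^sup>2 \<le> (B * vnorm H y)\<^sup>2" using pos by (intro power_mono) auto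
    then show ?thesis using S by simp
  qed simp
  then show ?thesis by (simp add: S_def c_def power_mult_distrib)
qed

end

section \<open>Orthogonal systems and closed spans\<close>

lemma sum_comb_swap:
  fixes c :: "'a \<Rightarrow> real"
  shows "(\<Sum>j\<in>J. c j * (\<Sum>t\<in>F. a j t * z t)) = (\<Sum>t\<in>F. (\<Sum>j\<in>J. c j * a j t) * z t)"
  by (simp add: sum_distrib_left sum_distrib_right mult.assoc) (rule sum.swap)

context rkhs
begin

lemma norm_orthogonal_comb_le:
  assumes J: "finite J" and f: "\<And>j. j \<in> J \<Longrightarrow> f j \<in> vcarrier H"
    and orth: "\<And>i j. i \<in> J \<Longrightarrow> j \<in> J \<Longrightarrow> i \<noteq> j \<Longrightarrow> vinner H (f i) (f j) = 0"
    and unit: "\<And>j. j \<in> J \<Longrightarrow> vinner H (f j) (f j) \<le> 1"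
  shows "vnorm H (\<lambda>t. \<Sum>j\<in>J. c j * f j t) \<le> sqrt (\<Sum>j\<in>J. (c j)\<^sup>2)"
proof -
  let ?u = "\<lambda>t. \<Sum>j\<in>J. c j * f j t"
  have u: "?u \<in> vcarrier H" using f by (intro sum_fun_closed) auto
  have "vinner H ?u ?u = (\<Sum>i\<in>J. c i * (\<Sum>j\<in>J. c j * vinner H (f i) (f j)))"
    using f u by (simp add: inner_sum_fun inner_sum_fun_right)
  also have "\<dots> = (\<Sum>i\<in>J. c i * (c i * vinner H (f i) (f i)))"
  proof (rule sum.cong[OF refl])
    fix i assume i: "i \<in> J"
    have "(\<Sum>j\<in>J. c j * vinner H (f i) (f j)) =
        (\<Sum>j\<in>J. if j = i then c i * vinner H (f i) (f i) else 0)"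
      using orth i by (intro sum.cong) auto
    then show "c i * (\<Sum>j\<in>J. c j * vinner H (f i) (f j)) = c i * (c i * vinner H (f i) (f i))"
      using i J by simp
  qed
  also have "\<dots> \<le> (\<Sum>i\<in>J. (c i)\<^sup>2)"
  proof (rule sum_mono)
    fix i assume "i \<in> J"
    then show "c i * (c i * vinner H (f i) (f i)) \<le> (c i)\<^sup>2"
      using mult_left_mono[OF unit, of i "(c i)\<^sup>2"] by (simp add: power2_eq_square mult.assoc)
  qed
  finally show ?thesis unfolding vnorm_def by (rule real_sqrt_le_mono)
qed

end

context rkhs
begin

text \<open>The closed linear span as a double orthogonal complement: in this form it is closed under sums and
  limits without any diagonal argument, and an element of it that is orthogonal to \<open>U\<close> vanishes.\<close>

definition closed_span :: "('t \<Rightarrow> real) set \<Rightarrow> ('t \<Rightarrow> real) set" where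
  "closed_span U = {f \<in> vcarrier H. \<forall>g\<in>vcarrier H. (\<forall>h\<in>U. vinner H h g = 0) \<longrightarrow> vinner H f g = 0}"

lemma closed_span_closed: "f \<in> closed_span U \<Longrightarrow> f \<in> vcarrier H"
  by (simp add: closed_span_def)

lemma closed_span_orthogonal:
  "f \<in> closed_span U \<Longrightarrow> g \<in> vcarrier H \<Longrightarrow> (\<And>h. h \<in> U \<Longrightarrow> vinner H h g = 0) \<Longrightarrow> vinner H f g = 0"
  by (simp add: closed_span_def)

lemma subset_closed_span: "U \<subseteq> vcarrier H \<Longrightarrow> U \<subseteq> closed_span U"
  by (auto simp: closed_span_def)

lemma zero_closed_span: "(\<lambda>t. 0) \<in> closed_span U"
  by (simp add: closed_span_def zero_fun_closed inner_zero_fun)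

lemma sum_closed_span:
  assumes "\<And>i. i \<in> I \<Longrightarrow> f i \<in> closed_span U"
  shows "(\<lambda>t. \<Sum>i\<in>I. c i * f i t) \<in> closed_span U"
  unfolding closed_span_def
proof (intro CollectI conjI ballI impI)
  show "(\<lambda>t. \<Sum>i\<in>I. c i * f i t) \<in> vcarrier H"
    by (intro sum_fun_closed closed_span_closed[OF assms])
  fix g assume g: "g \<in> vcarrier H" "\<forall>h\<in>U. vinner H h g = 0"
  have "vinner H (\<lambda>t. \<Sum>i\<in>I. c i * f i t) g = (\<Sum>i\<in>I. c i * vinner H (f i) g)"
    by (intro inner_sum_fun closed_span_closed[OF assms] g)
  also have "\<dots> = 0" using closed_span_orthogonal[OF assms] g by (intro sum.neutral) auto
  finally show "vinner H (\<lambda>t. \<Sum>i\<in>I. c i * f i t) g = 0" .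
qed

lemma scale_closed_span: "f \<in> closed_span U \<Longrightarrow> (\<lambda>t. a * f t) \<in> closed_span U"
  by (simp add: closed_span_def scale_fun_closed inner_scale_fun)

lemma diff_closed_span:
  "f \<in> closed_span U \<Longrightarrow> g \<in> closed_span U \<Longrightarrow> (\<lambda>t. f t - g t) \<in> closed_span U"
  by (simp add: closed_span_def diff_fun_closed inner_diff_fun)

lemma limit_closed_span:
  assumes x: "\<And>n. x n \<in> closed_span U" and l: "l \<in> vcarrier H"
    and conv: "(\<lambda>n. vnorm H (\<lambda>t. x n t - l t)) \<longlonglongrightarrow> 0"
  shows "l \<in> closed_span U"
proof -
  have "vinner H l g = 0" if g: "g \<in> vcarrier H" "\<forall>h\<in>U. vinner H h g = 0" for g
  proof -
    have "(\<lambda>n. vinner H (x n) g) \<longlonglongrightarrow> vinner H l g"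
      by (rule converges_inner[OF closed_span_closed[OF x] l g(1) conv])
    moreover have "vinner H (x n) g = 0" for n
      using closed_span_orthogonal[OF x] g by blast
    ultimately show ?thesis by (simp add: LIMSEQ_const_iff)
  qed
  then show ?thesis using l by (simp add: closed_span_def)
qed

lemma closed_span_nondegenerate:
  assumes "f \<in> closed_span U" "\<And>h. h \<in> U \<Longrightarrow> vinner H h f = 0"
  shows "f = (\<lambda>t. 0)"
  using closed_span_orthogonal[OF assms(1) closed_span_closed[OF assms(1)] assms(2)]
    norm_eq_zero_fun[OF closed_span_closed[OF assms(1)]] by blast

text \<open>The projection of \<open>f\<close> to the closure of \<open>U\<close> differs from \<open>f\<close> by an element that is orthogonal to \<open>U\<close>
  and lies in the span, hence is zero.\<close>

lemma closed_span_approx: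
  assumes U: "U \<subseteq> vcarrier H" "(\<lambda>t. 0) \<in> U"
    and lin: "\<And>f g a. f \<in> U \<Longrightarrow> g \<in> U \<Longrightarrow> (\<lambda>t. f t + a * g t) \<in> U"
    and f: "f \<in> closed_span U"
  obtains x where "\<And>n. x n \<in> U" "(\<lambda>n. vnorm H (\<lambda>t. x n t - f t)) \<longlonglongrightarrow> 0"
proof -
  have fH: "f \<in> vcarrier H" by (rule closed_span_closed[OF f])
  define R where "R = {(g, s). g \<in> U \<and> s = vinner H f g}"
  obtain v x where v: "v \<in> vcarrier H" "\<And>n. x n \<in> Domain R"
    "(\<lambda>n. vnorm H (\<lambda>t. x n t - v t)) \<longlonglongrightarrow> 0"
    "\<And>g s. (g, s) \<in> R \<Longrightarrow> vinner H v g = s"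
  proof (rule riesz_relation[of R "vnorm H f"])
    show "(\<lambda>t. 0, 0) \<in> R"
      using U inner_zero_fun[OF fH] inner_commute[OF fH zero_fun_closed] by (simp add: R_def)
    show "(\<lambda>t. g t + a * h t, s + a * s') \<in> R" if "(g, s) \<in> R" "(h, s') \<in> R" for g s h s' a
      using that lin fH U scale_fun_closed
      by (auto simp: R_def inner_add_fun_right inner_scale_fun_right subset_eq)
    show "g \<in> vcarrier H" if "(g, s) \<in> R" for g s using that U by (auto simp: R_def)
    show "\<bar>s\<bar> \<le> vnorm H f * vnorm H g" if "(g, s) \<in> R" for g s
      using that U by (auto simp: R_def intro: cauchy_schwarz fH)
  qed (use norm_nonneg[OF fH] in auto)
  have x: "x n \<in> U" for n using v(2)[of n] by (auto simp: R_def)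
  have "v \<in> closed_span U"
    by (rule limit_closed_span[OF _ v(1,3)]) (use x subset_closed_span[OF U(1)] in blast)
  then have d: "(\<lambda>t. f t - v t) \<in> closed_span U" by (rule diff_closed_span[OF f])
  have "vinner H h (\<lambda>t. f t - v t) = 0" if "h \<in> U" for h
  proof -
    have "h \<in> vcarrier H" using that U by blast
    then show ?thesis
      using v(4)[of h "vinner H f h"] that v(1) fH
      by (simp add: R_def inner_diff_fun_right inner_commute[of h])
  qed
  then have "(\<lambda>t. f t - v t) = (\<lambda>t. 0)" by (rule closed_span_nondegenerate[OF d])
  then have "v = f" by (simp add: fun_eq_iff)
  then show thesis using that x v(3) by blast
qed

lemma complete_orthonormal_subset:
  obtains E where "E \<subseteq> closed_span U"
    "\<And>f g. f \<in> E \<Longrightarrow> g \<in> E \<Longrightarrow> vinner H f g = (if f = g then 1 else 0)"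
    "\<And>f. f \<in> closed_span U \<Longrightarrow> \<forall>e\<in>E. vinner H f e = 0 \<Longrightarrow> f = (\<lambda>t. 0)"
proof -
  define \<E> where "\<E> = {E. E \<subseteq> closed_span U \<and>
    (\<forall>f\<in>E. \<forall>g\<in>E. vinner H f g = (if f = g then 1 else 0))}"
  have "\<exists>E\<in>\<E>. \<forall>F\<in>\<E>. E \<subseteq> F \<longrightarrow> F = E"
  proof (rule subset_Zorn')
    fix \<C> assume \<C>: "subset.chain \<E> \<C>"
    have "vinner H f g = (if f = g then 1 else 0)" if fg: "f \<in> \<Union>\<C>" "g \<in> \<Union>\<C>" for f g
    proof -
      obtain E F where EF: "f \<in> E" "E \<in> \<C>" "g \<in> F" "F \<in> \<C>" using fg by blast
      then have "E \<subseteq> F \<or> F \<subseteq> E" using \<C> unfolding subset_chain_def by blast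
      then obtain D where "D \<in> \<C>" "f \<in> D" "g \<in> D" using EF by blast
      then show ?thesis using \<C> unfolding subset_chain_def \<E>_def by blast
    qed
    moreover have "\<Union>\<C> \<subseteq> closed_span U" using \<C> unfolding subset_chain_def \<E>_def by blast
    ultimately show "\<Union>\<C> \<in> \<E>" unfolding \<E>_def by blast
  qed
  then obtain E where E: "E \<in> \<E>" and max: "\<And>F. F \<in> \<E> \<Longrightarrow> E \<subseteq> F \<Longrightarrow> F = E" by blast
  have Esub: "E \<subseteq> closed_span U"
    and orth: "\<And>f g. f \<in> E \<Longrightarrow> g \<in> E \<Longrightarrow> vinner H f g = (if f = g then 1 else 0)"
    using E by (auto simp: \<E>_def)
  have "f = (\<lambda>t. 0)" if f: "f \<in> closed_span U" and ortho: "\<forall>e\<in>E. vinner H f e = 0" for f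
  proof (rule ccontr)
    assume "f \<noteq> (\<lambda>t. 0)"
    have fH: "f \<in> vcarrier H" by (rule closed_span_closed[OF f])
    have "vnorm H f \<noteq> 0"
      using \<open>f \<noteq> (\<lambda>t. 0)\<close> norm_eq_zero_fun[OF fH] norm_sq[OF fH] by auto
    define u where "u = (\<lambda>t. (1 / vnorm H f) * f t)"
    have u: "u \<in> closed_span U" unfolding u_def by (rule scale_closed_span[OF f])
    have uH: "u \<in> vcarrier H" by (rule closed_span_closed[OF u])
    have "vnorm H u = 1"
      unfolding u_def norm_scale_fun[OF fH] using \<open>vnorm H f \<noteq> 0\<close> norm_nonneg[OF fH] by simp
    then have uu: "vinner H u u = 1" using norm_sq[OF uH] by simp
    have ue: "vinner H u e = 0" "vinner H e u = 0" if "e \<in> E" for e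
    proof -
      have eH: "e \<in> vcarrier H" using that Esub closed_span_closed by blast
      show "vinner H u e = 0" unfolding u_def inner_scale_fun[OF fH eH] using ortho that by simp
      then show "vinner H e u = 0" using inner_commute[OF eH uH] by simp
    qed
    have "u \<notin> E" using ue uu by fastforce
    moreover have "insert u E \<in> \<E>"
      unfolding \<E>_def using u Esub orth ue uu \<open>u \<notin> E\<close> by auto
    ultimately show False using max[of "insert u E"] by blast
  qed
  then show thesis using that Esub orth by blast
qed

text \<open>Members of the sequence may vanish, which covers spans of finite dimension. By Bessel's inequality
  the partial sums are Cauchy; the difference of \<open>h\<close> and their limit is orthogonal to all \<open>e n\<close>.\<close>

lemma orthogonal_expansion:
  assumes e: "\<And>n. e n \<in> closed_span U"
    and orth: "\<And>i j. i \<noteq> j \<Longrightarrow> vinner H (e i) (e j) = 0"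
    and unit: "\<And>n. vinner H (e n) (e n) = 1 \<or> e n = (\<lambda>t. 0)"
    and complete: "\<And>f. f \<in> closed_span U \<Longrightarrow> (\<And>n. vinner H f (e n) = 0) \<Longrightarrow> f = (\<lambda>t. 0)"
    and h: "h \<in> closed_span U"
  shows "(\<lambda>n. vnorm H (\<lambda>t. (\<Sum>i<n. vinner H h (e i) * e i t) - h t)) \<longlonglongrightarrow> 0"
proof -
  define c where "c i = vinner H h (e i)" for i
  define S where "S n = (\<lambda>t. \<Sum>i<n. c i * e i t)" for n :: nat
  define P where "P n = (\<Sum>i<n. (c i)\<^sup>2)" for n
  have hH: "h \<in> vcarrier H" and eH: "\<And>n. e n \<in> vcarrier H" using h e closed_span_closed by auto
  have S: "S n \<in> closed_span U" for n unfolding S_def by (intro sum_closed_span e)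
  have SH: "S n \<in> vcarrier H" for n by (rule closed_span_closed[OF S])
  have c_unit: "c i * vinner H (e i) (e i) = c i" for i
    using unit[of i] inner_zero_fun[OF hH] inner_commute[OF hH zero_fun_closed] by (auto simp: c_def)
  have S_e: "vinner H (S n) (e i) = (if i < n then c i else 0)" for n i
  proof -
    have "vinner H (S n) (e i) = (\<Sum>j<n. c j * vinner H (e j) (e i))"
      unfolding S_def by (rule inner_sum_fun) (auto intro: eH)
    also have "\<dots> = (\<Sum>j<n. if j = i then c i else 0)"
      using orth c_unit by (intro sum.cong) auto
    finally show ?thesis by simp
  qed
  have S_S: "vinner H (S n) (S m) = P n" if "n \<le> m" for n m
  proof -
    have "vinner H (S n) (S m) = (\<Sum>i<n. c i * vinner H (e i) (S m))"
      unfolding S_def[of n] by (rule inner_sum_fun) (auto intro: eH SH)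
    also have "\<dots> = P n"
      unfolding P_def using that
      by (intro sum.cong) (auto simp: inner_commute[OF eH SH] S_e power2_eq_square)
    finally show ?thesis .
  qed
  have h_S: "vinner H h (S n) = P n" for n
    unfolding S_def P_def
    by (subst inner_sum_fun_right) (auto simp: hH eH c_def power2_eq_square)
  have bessel: "P n \<le> vinner H h h" for n
  proof -
    have "0 \<le> vinner H (\<lambda>t. h t - S n t) (\<lambda>t. h t - S n t)"
      by (intro inner_ge_zero diff_fun_closed hH SH)
    also have "\<dots> = vinner H h h - P n"
      using norm_sq_add_scaled[OF hH SH, of "-1" n] by (simp add: h_S S_S)
    finally show ?thesis by simp
  qed
  have "convergent P"
  proof (rule Bseq_monoseq_convergent)
    show "Bseq P"
      by (rule BseqI'[of _ "vinner H h h"]) (use bessel in \<open>simp add: P_def sum_nonneg\<close>)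
    show "monoseq P" by (rule incseq_imp_monoseq) (auto simp: P_def incseq_def intro!: sum_mono2)
  qed
  then have "Cauchy P" by (rule convergent_Cauchy)
  have dist_S: "(vnorm H (\<lambda>t. S m t - S n t))\<^sup>2 = \<bar>P m - P n\<bar>" for m n
  proof -
    have P_mono: "n \<le> m \<Longrightarrow> P n \<le> P m" for n m by (auto simp: P_def intro!: sum_mono2)
    have *: "(vnorm H (\<lambda>t. S m t - S n t))\<^sup>2 = P m - P n" if "n \<le> m" for m n
    proof -
      have "vinner H (S m) (S n) = P n" using S_S[OF that] inner_commute[OF SH SH] by metis
      then show ?thesis
        using norm_sq_add_scaled[OF SH SH, of m "-1" n]
        by (simp add: norm_sq[OF diff_fun_closed[OF SH SH]] S_S)
    qed
    show ?thesis
    proof (cases "n \<le> m")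
      case True
      then show ?thesis using *[OF True] P_mono[OF True] by simp
    next
      case False
      then have "m \<le> n" by simp
      then show ?thesis
        using *[OF \<open>m \<le> n\<close>] P_mono[OF \<open>m \<le> n\<close>] unfolding norm_diff_commute[OF SH SH, of m n]
        by simp
    qed
  qed
  obtain l where l: "l \<in> vcarrier H" "(\<lambda>n. vnorm H (\<lambda>t. S n t - l t)) \<longlonglongrightarrow> 0"
  proof (rule cauchy_converges[OF SH])
    fix \<epsilon> :: real assume "0 < \<epsilon>"
    then obtain N where N: "\<And>m n. m \<ge> N \<Longrightarrow> n \<ge> N \<Longrightarrow> \<bar>P m - P n\<bar> < \<epsilon>\<^sup>2"
      using CauchyD[OF \<open>Cauchy P\<close>, of "\<epsilon>\<^sup>2"] by auto
    have "vnorm H (\<lambda>t. S m t - S n t) < \<epsilon>" if "m \<ge> N" "n \<ge> N" for m n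
    proof (rule power2_less_imp_less)
      show "(vnorm H (\<lambda>t. S m t - S n t))\<^sup>2 < \<epsilon>\<^sup>2" unfolding dist_S by (rule N[OF that])
      show "0 \<le> \<epsilon>" using \<open>0 < \<epsilon>\<close> by simp
    qed
    then show "\<exists>N. \<forall>m\<ge>N. \<forall>n\<ge>N. vnorm H (\<lambda>t. S m t - S n t) < \<epsilon>" by blast
  qed
  have l_e: "vinner H l (e i) = c i" for i
  proof (rule LIMSEQ_unique)
    show "(\<lambda>n. vinner H (S n) (e i)) \<longlonglongrightarrow> vinner H l (e i)"
      by (rule converges_inner[OF SH l(1) eH l(2)])
    show "(\<lambda>n. vinner H (S n) (e i)) \<longlonglongrightarrow> c i"
      unfolding S_e
      by (rule tendsto_eventually) (auto simp: eventually_sequentially intro!: exI[of _ "Suc i"])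
  qed
  have "(\<lambda>t. h t - l t) = (\<lambda>t. 0)"
  proof (rule complete)
    show "(\<lambda>t. h t - l t) \<in> closed_span U"
      by (rule diff_closed_span[OF h limit_closed_span[OF S l]])
    show "vinner H (\<lambda>t. h t - l t) (e n) = 0" for n
      using inner_diff_fun[OF hH l(1) eH] l_e by (simp add: c_def)
  qed
  then have "l = h" by (simp add: fun_eq_iff)
  then show ?thesis using l(2) by (simp add: S_def c_def)
qed

text \<open>The numbers \<open>f j t\<close> are the coefficients of the kernel section at \<open>t\<close>, whose norm is at most \<open>b t\<close>:
  applied to this section itself, the envelope condition reads \<open>\<parallel>k\<parallel>\<^sup>2 \<le> \<parallel>k\<parallel> * b t\<close>.\<close>

lemma envelope_sum_sq_le:
  assumes b: "envelope H b" and J: "finite J" and f: "\<And>j. j \<in> J \<Longrightarrow> f j \<in> vcarrier H"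
    and orth: "\<And>i j. i \<in> J \<Longrightarrow> j \<in> J \<Longrightarrow> i \<noteq> j \<Longrightarrow> vinner H (f i) (f j) = 0"
    and unit: "\<And>j. j \<in> J \<Longrightarrow> vinner H (f j) (f j) \<le> 1"
  shows "(\<Sum>j\<in>J. (f j t)\<^sup>2) \<le> (b t)\<^sup>2"
proof -
  let ?k = "kernel_section t"
  have k: "?k \<in> vcarrier H" by (rule kernel_section)
  have "(vnorm H ?k)\<^sup>2 = ?k t" using kernel_section(2)[OF k] norm_sq[OF k] by simp
  also have "\<dots> \<le> vnorm H ?k * b t" using b k unfolding envelope_def by (meson abs_le_D1)
  finally have *: "vnorm H ?k * vnorm H ?k \<le> vnorm H ?k * b t" by (simp add: power2_eq_square)
  have kb: "vnorm H ?k \<le> b t"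
  proof (cases "vnorm H ?k = 0")
    case True
    then show ?thesis using b by (simp add: envelope_def)
  next
    case False
    then show ?thesis using * norm_nonneg[OF k] by (simp add: mult_le_cancel_left)
  qed
  have "(\<Sum>j\<in>J. (f j t)\<^sup>2) = (\<Sum>j\<in>J. (vinner H ?k (f j))\<^sup>2)"
    using f by (intro sum.cong) (simp_all add: inner_commute[OF k] kernel_section)
  also have "\<dots> \<le> 1\<^sup>2 * (vnorm H ?k)\<^sup>2"
    using norm_orthogonal_comb_le[OF J f orth unit]
    by (intro dual_of_coefficient_bound J f k) auto
  also have "\<dots> \<le> (b t)\<^sup>2" using kb norm_nonneg[OF k] by (simp add: power_mono)
  finally show ?thesis .
qed

end

section \<open>Concentration of Gaussian variables\<close>

definition centered_gaussian_var :: "'w measure \<Rightarrow> ('w \<Rightarrow> real) \<Rightarrow> bool" where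
  "centered_gaussian_var M g \<longleftrightarrow>
     g \<in> borel_measurable M \<and> gaussian_measure (distr M borel g) \<and> (LINT \<omega>|M. g \<omega>) = 0"

lemma normal_density_le:
  assumes "0 < \<sigma>" shows "normal_density m \<sigma> x \<le> 1 / (2 * \<sigma>)"
proof -
  have "2\<^sup>2 * \<sigma>\<^sup>2 \<le> 2 * pi * \<sigma>\<^sup>2" using pi_gt3 by (intro mult_right_mono) auto
  then have "2 * \<sigma> \<le> sqrt (2 * pi * \<sigma>\<^sup>2)"
    by (intro real_le_rsqrt) (simp add: power_mult_distrib)
  then have "1 / sqrt (2 * pi * \<sigma>\<^sup>2) \<le> 1 / (2 * \<sigma>)" using assms by (intro divide_left_mono) auto
  moreover have "exp (- (x - m)\<^sup>2 / (2 * \<sigma>\<^sup>2)) \<le> 1" by simp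
  ultimately have "1 / sqrt (2 * pi * \<sigma>\<^sup>2) * exp (- (x - m)\<^sup>2 / (2 * \<sigma>\<^sup>2)) \<le> 1 / (2 * \<sigma>) * 1"
    using assms by (intro mult_mono) auto
  then show ?thesis by (simp add: normal_density_def)
qed

context prob_space
begin

lemma centered_gaussian_var_cases:
  assumes g: "centered_gaussian_var M g"
  obtains "AE \<omega> in M. g \<omega> = 0"
    | \<sigma> where "0 < \<sigma>" "distr M borel g = density lborel (\<lambda>x. ennreal (normal_density 0 \<sigma> x))"
proof -
  have [measurable]: "g \<in> borel_measurable M" and mean: "expectation g = 0"
    using g by (auto simp: centered_gaussian_var_def)
  have mean': "(LINT x|distr M borel g. x) = 0" using mean by (simp add: integral_distr)
  consider m \<sigma> where "0 < \<sigma>" "distr M borel g = density lborel (\<lambda>x. ennreal (normal_density m \<sigma> x))"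
    | m where "distr M borel g = return borel m"
    using g by (auto simp: centered_gaussian_var_def gaussian_measure_def)
  then show thesis
  proof cases
    case 1
    have "m = (LINT x|lborel. normal_density m \<sigma> x * x)"
      using integral_normal_moment_nz_1[OF 1(1), of m] by simp
    also have "\<dots> = (LINT x|distr M borel g. x)"
      unfolding 1(2) by (subst integral_density) (auto simp: mult.commute)
    finally have "m = 0" using mean' by simp
    then show thesis using 1 that(2) by simp
  next
    case 2
    then have "m = 0" using mean' by (simp add: integral_return)
    moreover have "AE x in distr M borel g. x = m" unfolding 2 by (simp add: AE_return)
    ultimately have "AE \<omega> in M. g \<omega> = 0" by (simp add: AE_distr_iff)
    then show thesis by (rule that(1))
  qed
qed

lemma integrable_gaussian_power:
  assumes g: "centered_gaussian_var M g"
  shows "integrable M (\<lambda>\<omega>. g \<omega> ^ k)"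
proof -
  have [measurable]: "g \<in> borel_measurable M" using g by (auto simp: centered_gaussian_var_def)
  from g show ?thesis
  proof (cases rule: centered_gaussian_var_cases)
    case 1
    then have "integrable M (\<lambda>\<omega>. g \<omega> ^ k) \<longleftrightarrow> integrable M (\<lambda>\<omega>. 0 ^ k :: real)"
      by (intro integrable_cong_AE) auto
    then show ?thesis by simp
  next
    case (2 \<sigma>)
    have "integrable (distr M borel g) (\<lambda>x. x ^ k)"
      unfolding 2(2) using integrable_normal_moment[OF 2(1), of 0 k]
      by (subst integrable_density) auto
    then show ?thesis by (simp add: integrable_distr_eq)
  qed
qed

lemma expectation_gaussian_even_power:
  assumes "g \<in> borel_measurable M" "0 < \<sigma>"
    and "distr M borel g = density lborel (\<lambda>x. ennreal (normal_density 0 \<sigma> x))"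
  shows "expectation (\<lambda>\<omega>. g \<omega> ^ (2 * k)) = fact (2 * k) / ((2 / \<sigma>\<^sup>2)^k * fact k)"
proof -
  note [measurable] = assms(1)
  have "expectation (\<lambda>\<omega>. g \<omega> ^ (2 * k)) = (LINT x|distr M borel g. x ^ (2 * k))"
    by (simp add: integral_distr)
  also have "\<dots> = (LINT x|lborel. normal_density 0 \<sigma> x * (x - 0) ^ (2 * k))"
    unfolding assms(3) by (subst integral_density) auto
  finally show ?thesis using integral_normal_moment_even[OF assms(2), of 0 k] by simp
qed

lemma gaussian_fourth_moment:
  assumes g: "centered_gaussian_var M g"
  shows "expectation (\<lambda>\<omega>. g \<omega> ^ 4) = 3 * (expectation (\<lambda>\<omega>. (g \<omega>)\<^sup>2))\<^sup>2"
proof -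
  have [measurable]: "g \<in> borel_measurable M" using g by (auto simp: centered_gaussian_var_def)
  from g show ?thesis
  proof (cases rule: centered_gaussian_var_cases)
    case 1
    have "expectation (\<lambda>\<omega>. g \<omega> ^ k) = expectation (\<lambda>\<omega>. 0 ^ k)" for k
      using 1 by (intro integral_cong_AE) auto
    then show ?thesis by simp
  next
    case (2 \<sigma>)
    have "expectation (\<lambda>\<omega>. (g \<omega>)\<^sup>2) = \<sigma>\<^sup>2"
      using expectation_gaussian_even_power[OF _ 2, of 1] by simp
    moreover have "expectation (\<lambda>\<omega>. g \<omega> ^ 4) = 3 * \<sigma> ^ 4"
      using expectation_gaussian_even_power[OF _ 2, of 2]
      by (simp add: fact_numeral field_simps power2_eq_square power4_eq_xxxx)
    ultimately show ?thesis by (simp add: power4_eq_xxxx power2_eq_square)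
  qed
qed

text \<open>A normal density with standard deviation \<open>\<sigma>\<close> is at most \<open>1 / (2 * \<sigma>)\<close>, so an interval of length
  \<open>2 * e\<close> has probability at most \<open>e / \<sigma>\<close>. The product form also covers \<open>\<sigma> = 0\<close>.\<close>

lemma gaussian_anticoncentration:
  assumes g: "centered_gaussian_var M g" and e: "0 \<le> e"
  shows "prob {\<omega> \<in> space M. \<bar>g \<omega>\<bar> \<le> e} * sqrt (expectation (\<lambda>\<omega>. (g \<omega>)\<^sup>2)) \<le> e"
proof -
  have [measurable]: "g \<in> borel_measurable M" using g by (auto simp: centered_gaussian_var_def)
  from g show ?thesis
  proof (cases rule: centered_gaussian_var_cases)
    case 1
    then have "expectation (\<lambda>\<omega>. (g \<omega>)\<^sup>2) = expectation (\<lambda>\<omega>. 0)"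
      by (intro integral_cong_AE) auto
    then show ?thesis using e by simp
  next
    case (2 \<sigma>)
    have V: "expectation (\<lambda>\<omega>. (g \<omega>)\<^sup>2) = \<sigma>\<^sup>2"
      using expectation_gaussian_even_power[OF _ 2, of 1] by simp
    have "emeasure M {\<omega> \<in> space M. \<bar>g \<omega>\<bar> \<le> e} = emeasure (distr M borel g) {-e..e}"
      by (subst emeasure_distr) (auto intro!: arg_cong[where f="emeasure M"])
    also have "\<dots> = (\<integral>\<^sup>+x. ennreal (normal_density 0 \<sigma> x) * indicator {-e..e} x \<partial>lborel)"
      unfolding 2(2) by (rule emeasure_density) auto
    also have "\<dots> \<le> (\<integral>\<^sup>+x. ennreal (1 / (2 * \<sigma>)) * indicator {-e..e} x \<partial>lborel)"
      using normal_density_le[OF 2(1)] by (intro nn_integral_mono mult_right_mono ennreal_leI) auto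
    also have "\<dots> = ennreal (1 / (2 * \<sigma>)) * ennreal (2 * e)"
      using e by (subst nn_integral_cmult_indicator) auto
    also have "\<dots> = ennreal (e / \<sigma>)"
      using 2(1) e by (simp flip: ennreal_mult)
    finally have "prob {\<omega> \<in> space M. \<bar>g \<omega>\<bar> \<le> e} \<le> e / \<sigma>"
      using 2(1) e by (simp add: emeasure_eq_measure)
    then show ?thesis using 2(1) V by (simp add: field_simps)
  qed
qed

lemma integrable_gaussian_mult:
  assumes "centered_gaussian_var M u" "centered_gaussian_var M v"
  shows "integrable M (\<lambda>\<omega>. u \<omega> * v \<omega>)"
proof -
  have [measurable]: "u \<in> borel_measurable M" "v \<in> borel_measurable M"
    using assms by (auto simp: centered_gaussian_var_def)
  show ?thesis
  proof (rule Bochner_Integration.integrable_bound)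
    show "integrable M (\<lambda>\<omega>. (u \<omega>)\<^sup>2 + (v \<omega>)\<^sup>2)"
      by (intro Bochner_Integration.integrable_add integrable_gaussian_power assms)
    have "\<bar>x * y\<bar> \<le> x\<^sup>2 + y\<^sup>2" for x y :: real
      using zero_le_power2[of "x + y"] zero_le_power2[of "x - y"] zero_le_power2[of x]
        zero_le_power2[of y] unfolding power2_sum power2_diff by (intro abs_leI) linarith+
    then show "AE \<omega> in M. norm (u \<omega> * v \<omega>) \<le> norm ((u \<omega>)\<^sup>2 + (v \<omega>)\<^sup>2)"
      by simp
  qed simp
qed

text \<open>Isserlis' formula for two variables follows from the fourth moment of one variable by polarization:
  \<open>12 u\<^sup>2 v\<^sup>2 = (u + v)\<^sup>4 + (u - v)\<^sup>4 - 2 u\<^sup>4 - 2 v\<^sup>4\<close>.\<close>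

lemma gaussian_isserlis:
  assumes u: "centered_gaussian_var M u" and v: "centered_gaussian_var M v"
    and add: "centered_gaussian_var M (\<lambda>\<omega>. u \<omega> + v \<omega>)"
    and diff: "centered_gaussian_var M (\<lambda>\<omega>. u \<omega> - v \<omega>)"
  shows "integrable M (\<lambda>\<omega>. (u \<omega>)\<^sup>2 * (v \<omega>)\<^sup>2)" (is ?int)
    and "expectation (\<lambda>\<omega>. (u \<omega>)\<^sup>2 * (v \<omega>)\<^sup>2) =
      expectation (\<lambda>\<omega>. (u \<omega>)\<^sup>2) * expectation (\<lambda>\<omega>. (v \<omega>)\<^sup>2)
      + 2 * (expectation (\<lambda>\<omega>. u \<omega> * v \<omega>))\<^sup>2" (is ?eq)
proof -
  note int = integrable_gaussian_power[OF u] integrable_gaussian_power[OF v]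
    integrable_gaussian_power[OF add] integrable_gaussian_power[OF diff]
    integrable_gaussian_mult[OF u v]
  have polar: "(u \<omega>)\<^sup>2 * (v \<omega>)\<^sup>2 =
      (1/12) * ((u \<omega> + v \<omega>) ^ 4 + (u \<omega> - v \<omega>) ^ 4 - 2 * u \<omega> ^ 4 - 2 * v \<omega> ^ 4)" for \<omega>
    by (simp add: power4_eq_xxxx power2_eq_square algebra_simps)
  show ?int unfolding polar using int by simp
  let ?a = "expectation (\<lambda>\<omega>. (u \<omega>)\<^sup>2)" and ?b = "expectation (\<lambda>\<omega>. (v \<omega>)\<^sup>2)"
    and ?c = "expectation (\<lambda>\<omega>. u \<omega> * v \<omega>)"
  have E_add: "expectation (\<lambda>\<omega>. (u \<omega> + v \<omega>)\<^sup>2) = ?a + ?b + 2 * ?c"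
    using int by (simp add: power2_sum mult.assoc)
  have E_diff: "expectation (\<lambda>\<omega>. (u \<omega> - v \<omega>)\<^sup>2) = ?a + ?b - 2 * ?c"
    using int by (simp add: power2_diff mult.assoc)
  have E_prod: "expectation (\<lambda>\<omega>. (u \<omega>)\<^sup>2 * (v \<omega>)\<^sup>2) = (1/12) *
      (expectation (\<lambda>\<omega>. (u \<omega> + v \<omega>) ^ 4) + expectation (\<lambda>\<omega>. (u \<omega> - v \<omega>) ^ 4)
      - 2 * expectation (\<lambda>\<omega>. u \<omega> ^ 4) - 2 * expectation (\<lambda>\<omega>. v \<omega> ^ 4))"
    unfolding polar using int by simp
  show ?eq
    unfolding E_prod gaussian_fourth_moment[OF u] gaussian_fourth_moment[OF v]
      gaussian_fourth_moment[OF add] gaussian_fourth_moment[OF diff] E_add E_diff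
    by (simp add: power2_eq_square algebra_simps)
qed

text \<open>The sum \<open>Q\<close> of the squares has mean \<open>\<tau>\<close>, the trace of the covariance matrix \<open>c\<close>, and variance
  \<open>2 * (\<Sum>i j. (c i j)\<^sup>2) \<le> 2 * D * \<tau>\<close>. Unless \<open>\<tau> \<le> 2 * R\<close>, the event \<open>Q \<le> R\<close> requires a deviation of
  at least \<open>\<tau> / 2\<close> from the mean, which has probability at most \<open>8 * D / \<tau>\<close> by Chebyshev's inequality.\<close>

lemma gaussian_trace_bound:
  assumes J: "finite J"
    and gauss: "\<And>c. centered_gaussian_var M (\<lambda>\<omega>. \<Sum>j\<in>J. c j * G j \<omega>)"
    and var: "\<And>c. expectation (\<lambda>\<omega>. (\<Sum>j\<in>J. c j * G j \<omega>)\<^sup>2) \<le> D * (\<Sum>j\<in>J. (c j)\<^sup>2)"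
    and p: "0 < p" "p \<le> prob {\<omega> \<in> space M. (\<Sum>j\<in>J. (G j \<omega>)\<^sup>2) \<le> R}"
    and "0 < D" "0 \<le> R"
  shows "(\<Sum>j\<in>J. expectation (\<lambda>\<omega>. (G j \<omega>)\<^sup>2)) \<le> 2 * R + 8 * D / p"
proof -
  define s where "s j = expectation (\<lambda>\<omega>. (G j \<omega>)\<^sup>2)" for j
  define c where "c i j = expectation (\<lambda>\<omega>. G i \<omega> * G j \<omega>)" for i j
  define Q where "Q \<omega> = (\<Sum>j\<in>J. (G j \<omega>)\<^sup>2)" for \<omega>
  define \<tau> where "\<tau> = (\<Sum>j\<in>J. s j)"
  have s_nonneg: "0 \<le> s j" for j by (simp add: s_def)
  have two: "centered_gaussian_var M (\<lambda>\<omega>. x * G i \<omega> + y * G j \<omega>)" if "i \<in> J" "j \<in> J" for x y i j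
  proof -
    have "(\<Sum>k\<in>J. ((if k = i then x else 0) + (if k = j then y else 0)) * G k \<omega>)
        = x * G i \<omega> + y * G j \<omega>" for \<omega>
      using J that by (simp add: distrib_right sum.distrib if_distrib[of "\<lambda>z. z * _"] cong: if_cong)
    then show ?thesis
      using gauss[of "\<lambda>k. (if k = i then x else 0) + (if k = j then y else 0)"] by simp
  qed
  have one: "centered_gaussian_var M (G j)" if "j \<in> J" for j
    using two[OF that that, of 1 0] by simp
  have iss: "integrable M (\<lambda>\<omega>. (G i \<omega>)\<^sup>2 * (G j \<omega>)\<^sup>2)"
    "expectation (\<lambda>\<omega>. (G i \<omega>)\<^sup>2 * (G j \<omega>)\<^sup>2) = s i * s j + 2 * (c i j)\<^sup>2"
    if "i \<in> J" "j \<in> J" for i j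
    using gaussian_isserlis[OF one[OF that(1)] one[OF that(2)]] two[OF that, of 1 1]
      two[OF that, of 1 "-1"] by (simp_all add: s_def c_def)
  \<comment> \<open>\<open>D\<close> bounds the operator norm of \<open>c\<close>, so \<open>\<parallel>c x\<parallel>\<^sup>2 \<le> D * \<langle>c x, x\<rangle>\<close>; for the \<open>i\<close>-th unit vector \<open>x\<close> this is the claim.\<close>
  have row: "(\<Sum>j\<in>J. (c i j)\<^sup>2) \<le> D * s i" if i: "i \<in> J" for i
  proof -
    define L where "L \<omega> = (\<Sum>j\<in>J. c i j * G j \<omega>)" for \<omega>
    define a where "a = (\<Sum>j\<in>J. (c i j)\<^sup>2)"
    have L: "centered_gaussian_var M L" unfolding L_def by (rule gauss)
    have "a = (\<Sum>j\<in>J. c i j * expectation (\<lambda>\<omega>. G i \<omega> * G j \<omega>))"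
      by (simp add: a_def c_def power2_eq_square)
    also have "\<dots> = expectation (\<lambda>\<omega>. \<Sum>j\<in>J. c i j * (G i \<omega> * G j \<omega>))"
      using integrable_gaussian_mult[OF one[OF i] one] by (simp add: integral_sum)
    also have "\<dots> = expectation (\<lambda>\<omega>. G i \<omega> * L \<omega>)"
      by (simp add: L_def sum_distrib_left mult_ac)
    finally have aL: "a = expectation (\<lambda>\<omega>. G i \<omega> * L \<omega>)" .
    have "0 \<le> expectation (\<lambda>\<omega>. (D * G i \<omega> - L \<omega>)\<^sup>2)" by simp
    also have "\<dots> = D\<^sup>2 * s i - 2 * D * a + expectation (\<lambda>\<omega>. (L \<omega>)\<^sup>2)"
      using integrable_gaussian_mult[OF one[OF i] L] integrable_gaussian_power[OF L, of 2]
        integrable_gaussian_power[OF one[OF i], of 2]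
      by (simp add: power2_diff power_mult_distrib s_def aL mult.assoc)
    also have "\<dots> \<le> D\<^sup>2 * s i - 2 * D * a + D * a"
      using var[of "c i"] by (simp add: L_def a_def)
    finally have "D * a \<le> D * (D * s i)" by (simp add: power2_eq_square algebra_simps)
    then show ?thesis using \<open>0 < D\<close> by (simp add: a_def)
  qed
  have intQ: "integrable M Q" unfolding Q_def
    by (intro Bochner_Integration.integrable_sum integrable_gaussian_power one)
  have Q2: "(Q \<omega>)\<^sup>2 = (\<Sum>i\<in>J. \<Sum>j\<in>J. (G i \<omega>)\<^sup>2 * (G j \<omega>)\<^sup>2)" for \<omega>
    by (simp add: Q_def power2_eq_square sum_product)
  have intQ2: "integrable M (\<lambda>\<omega>. (Q \<omega>)\<^sup>2)" unfolding Q2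
    by (intro Bochner_Integration.integrable_sum iss)
  have EQ: "expectation Q = \<tau>"
    unfolding Q_def \<tau>_def s_def
    by (rule Bochner_Integration.integral_sum) (rule integrable_gaussian_power[OF one])
  have "expectation (\<lambda>\<omega>. (Q \<omega>)\<^sup>2) = (\<Sum>i\<in>J. \<Sum>j\<in>J. s i * s j + 2 * (c i j)\<^sup>2)"
    unfolding Q2 using iss by simp
  also have "\<dots> = \<tau>\<^sup>2 + 2 * (\<Sum>i\<in>J. \<Sum>j\<in>J. (c i j)\<^sup>2)"
    unfolding \<tau>_def power2_eq_square sum_product by (simp add: sum.distrib sum_distrib_left)
  also have "\<dots> \<le> \<tau>\<^sup>2 + 2 * (\<Sum>i\<in>J. D * s i)"
    using row by (intro add_left_mono mult_left_mono sum_mono) auto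
  finally have "variance Q \<le> 2 * D * \<tau>"
    using variance_eq[OF intQ intQ2] by (simp add: EQ \<tau>_def sum_distrib_left mult.assoc)
  note varQ = this
  show ?thesis
  proof (cases "\<tau> \<le> 2 * R")
    case True
    moreover have "0 \<le> 8 * D / p" using assms by simp
    ultimately show ?thesis by (simp add: \<tau>_def s_def)
  next
    case False
    then have \<tau>: "\<tau> > 0" "R < \<tau> / 2" using assms by auto
    have [measurable]: "Q \<in> borel_measurable M" using intQ by simp
    have "p \<le> prob {\<omega> \<in> space M. \<bar>Q \<omega> - \<tau>\<bar> \<ge> \<tau> / 2}"
      using \<tau> unfolding Q_def[symmetric]
      by (intro order_trans[OF p(2)[folded Q_def]] finite_measure_mono) auto
    also have "\<dots> \<le> variance Q / (\<tau> / 2)\<^sup>2"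
      using Chebyshev_inequality[of Q "\<tau> / 2"] intQ2 \<tau> by (simp add: EQ)
    also have "\<dots> \<le> 2 * D * \<tau> / (\<tau> / 2)\<^sup>2"
      using varQ by (intro divide_right_mono) auto
    also have "\<dots> = 8 * D / \<tau>" using \<tau> by (simp add: power2_eq_square field_simps)
    finally have "\<tau> \<le> 8 * D / p" using p(1) \<tau> by (simp add: field_simps)
    then show ?thesis using assms by (simp add: \<tau>_def s_def)
  qed
qed

end

section \<open>Gaussian paths in a ball\<close>

text \<open>The setting of the probabilistic part. On the set \<open>A\<close> the paths lie in a ball of \<open>H\<close>. This set may
  be non-measurable, and the assumption \<open>outer\<close> says that its outer probability is at least \<open>q\<close>.
  The space \<open>HX\<close> is the reproducing kernel Hilbert space of the covariance of \<open>Y\<close>.\<close>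

locale gaussian_paths = H: rkhs H + X: rkhs HX + prob_space M
  for H HX :: "('t \<Rightarrow> real) inner_space" and M :: "'w measure" +
  fixes Y :: "'t \<Rightarrow> 'w \<Rightarrow> real" and A :: "'w set" and r q :: real
  assumes gaussian: "\<And>F a. finite F \<Longrightarrow> centered_gaussian_var M (\<lambda>\<omega>. \<Sum>t\<in>F. a t * Y t \<omega>)"
    and kernel: "\<And>t. (\<lambda>s. expectation (\<lambda>\<omega>. Y s \<omega> * Y t \<omega>)) \<in> vcarrier HX"
    and reproducing: "\<And>h t. h \<in> vcarrier HX \<Longrightarrow>
      vinner HX h (\<lambda>s. expectation (\<lambda>\<omega>. Y s \<omega> * Y t \<omega>)) = h t"
    and A_space: "A \<subseteq> space M"
    and paths: "\<And>\<omega>. \<omega> \<in> A \<Longrightarrow> (\<lambda>t. Y t \<omega>) \<in> vcarrier H \<and> vnorm H (\<lambda>t. Y t \<omega>) \<le> r"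
    and outer: "\<And>E. E \<in> sets M \<Longrightarrow> A \<subseteq> E \<Longrightarrow> q \<le> prob E"
    and pos: "0 < r" "0 < q"
begin

definition std_dev :: "'t set \<Rightarrow> ('t \<Rightarrow> real) \<Rightarrow> real" where
  "std_dev F a = sqrt (expectation (\<lambda>\<omega>. (\<Sum>t\<in>F. a t * Y t \<omega>)\<^sup>2))"

lemma std_dev_nonneg: "0 \<le> std_dev F a"
  by (simp add: std_dev_def)

lemma std_dev_sq: "(std_dev F a)\<^sup>2 = expectation (\<lambda>\<omega>. (\<Sum>t\<in>F. a t * Y t \<omega>)\<^sup>2)"
  by (simp add: std_dev_def)

lemma path_inner_kernel_comb:
  "\<omega> \<in> A \<Longrightarrow> vinner H (\<lambda>t. Y t \<omega>) (H.kernel_comb F a) = (\<Sum>t\<in>F. a t * Y t \<omega>)"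
  using paths by (simp add: H.inner_kernel_comb)

text \<open>On \<open>A\<close> the variable \<open>\<Sum>t\<in>F. a t * Y t\<close> is the inner product of the path with a combination of kernel
  sections, hence bounded by \<open>r\<close> times the norm of this combination. Anticoncentration turns this
  bound on a set of outer probability \<open>q\<close> into a bound of the standard deviation.\<close>

lemma std_dev_le:
  assumes F: "finite F"
  shows "std_dev F a \<le> r / q * vnorm H (H.kernel_comb F a)"
proof -
  let ?g = "\<lambda>\<omega>. \<Sum>t\<in>F. a t * Y t \<omega>" and ?f = "H.kernel_comb F a"
  define e where "e = r * vnorm H ?f"
  have e: "0 \<le> e" using pos H.norm_nonneg[OF H.kernel_comb_closed] by (simp add: e_def)
  have [measurable]: "?g \<in> borel_measurable M"
    using gaussian[OF F] by (simp add: centered_gaussian_var_def)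
  have "q \<le> prob {\<omega> \<in> space M. \<bar>?g \<omega>\<bar> \<le> e}"
  proof (rule outer)
    show "A \<subseteq> {\<omega> \<in> space M. \<bar>?g \<omega>\<bar> \<le> e}"
    proof safe
      fix \<omega> assume \<omega>: "\<omega> \<in> A"
      show "\<omega> \<in> space M" using \<omega> A_space by blast
      have "\<bar>vinner H (\<lambda>t. Y t \<omega>) ?f\<bar> \<le> vnorm H (\<lambda>t. Y t \<omega>) * vnorm H ?f"
        using paths[OF \<omega>] by (intro H.cauchy_schwarz H.kernel_comb_closed) auto
      also have "\<dots> \<le> e"
        using paths[OF \<omega>] unfolding e_def
        by (intro mult_right_mono H.norm_nonneg H.kernel_comb_closed) auto
      finally show "\<bar>?g \<omega>\<bar> \<le> e" by (simp add: path_inner_kernel_comb[OF \<omega>])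
    qed
  qed simp
  then have "q * std_dev F a \<le> prob {\<omega> \<in> space M. \<bar>?g \<omega>\<bar> \<le> e} * std_dev F a"
    by (intro mult_right_mono std_dev_nonneg)
  also have "\<dots> \<le> e"
    unfolding std_dev_def by (rule gaussian_anticoncentration[OF gaussian[OF F] e])
  finally show ?thesis using pos by (simp add: e_def field_simps)
qed

text \<open>The functional \<open>h \<mapsto> (\<Sum>t\<in>F. a t * h t)\<close> on \<open>HX\<close> is represented by the same combination of covariance
  sections, whose norm is the standard deviation.\<close>

lemma X_functional_le:
  assumes h: "h \<in> vcarrier HX" and F: "finite F"
  shows "\<bar>\<Sum>t\<in>F. a t * h t\<bar> \<le> vnorm HX h * std_dev F a"
proof -
  define k where "k t = (\<lambda>s. expectation (\<lambda>\<omega>. Y s \<omega> * Y t \<omega>))" for t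
  define u where "u = (\<lambda>s. \<Sum>t\<in>F. a t * k t s)"
  have k: "k t \<in> vcarrier HX" for t using kernel by (simp add: k_def)
  have rep: "vinner HX g (k t) = g t" if "g \<in> vcarrier HX" for g t
    using reproducing[OF that] by (simp add: k_def)
  have u: "u \<in> vcarrier HX" unfolding u_def by (intro X.sum_fun_closed k)
  have comb: "vinner HX g u = (\<Sum>t\<in>F. a t * g t)" if "g \<in> vcarrier HX" for g
    using that unfolding u_def by (subst X.inner_sum_fun_right) (simp_all add: k rep)
  have gauss1: "centered_gaussian_var M (Y t)" for t using gaussian[of "{t}" "\<lambda>_. 1"] by simp
  have "(std_dev F a)\<^sup>2 = expectation (\<lambda>\<omega>. \<Sum>t\<in>F. \<Sum>s\<in>F. a t * a s * (Y t \<omega> * Y s \<omega>))"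
    unfolding std_dev_sq by (simp add: power2_eq_square sum_product mult_ac)
  also have "\<dots> = (\<Sum>t\<in>F. \<Sum>s\<in>F. a t * a s * expectation (\<lambda>\<omega>. Y t \<omega> * Y s \<omega>))"
    using integrable_gaussian_mult[OF gauss1 gauss1] by simp
  also have "\<dots> = vinner HX u u"
    unfolding comb[OF u] by (simp add: u_def k_def sum_distrib_left mult_ac)
  finally have "vnorm HX u = std_dev F a"
    unfolding vnorm_def by (rule real_sqrt_unique[OF _ std_dev_nonneg])
  then show ?thesis using X.cauchy_schwarz[OF h u] comb[OF h] by simp
qed

text \<open>By the two preceding bounds, \<open>h\<close> defines a bounded functional on the span of the kernel sections of
  \<open>H\<close>, namely \<open>(\<Sum>t. a\<^sub>t k\<^sub>H(\<cdot>, t)) \<mapsto> (\<Sum>t. a\<^sub>t h(t))\<close>. Its representer in \<open>H\<close> has the values of \<open>h\<close>.\<close>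

lemma X_subset_H:
  assumes h: "h \<in> vcarrier HX"
  shows "h \<in> vcarrier H" "vnorm H h \<le> r / q * vnorm HX h"
proof -
  define R where "R = {(H.kernel_comb F a, \<Sum>t\<in>F. a t * h t) | F a. finite F}"
  let ?c = "r / q * vnorm HX h"
  have R_cases: "\<exists>F a. finite F \<and> f = H.kernel_comb F a \<and> s = (\<Sum>t\<in>F. a t * h t)"
    if "(f, s) \<in> R" for f s using that by (auto simp: R_def)
  have c: "0 \<le> ?c" using pos X.norm_nonneg[OF h] by simp
  obtain v where v: "v \<in> vcarrier H" "\<And>f s. (f, s) \<in> R \<Longrightarrow> vinner H v f = s" "vnorm H v \<le> ?c"
  proof (rule H.riesz_relation[of R ?c])
    have "(H.kernel_comb {} (\<lambda>t. 0), \<Sum>t\<in>{}. 0 * h t) \<in> R" unfolding R_def by blast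
    then show "(\<lambda>t. 0, 0) \<in> R" by (simp add: H.kernel_comb_def)
    show "(\<lambda>t. f t + a * g t, x + a * y) \<in> R" if "(f, x) \<in> R" "(g, y) \<in> R" for f x g y a
    proof -
      obtain F b where F: "finite F" "f = H.kernel_comb F b" "x = (\<Sum>t\<in>F. b t * h t)"
        using R_cases[OF \<open>(f, x) \<in> R\<close>] by blast
      obtain G c where G: "finite G" "g = H.kernel_comb G c" "y = (\<Sum>t\<in>G. c t * h t)"
        using R_cases[OF \<open>(g, y) \<in> R\<close>] by blast
      obtain d where "(\<lambda>s. H.kernel_comb F b s + a * H.kernel_comb G c s) = H.kernel_comb (F \<union> G) d"
        "\<And>z. (\<Sum>t\<in>F. b t * z t) + a * (\<Sum>t\<in>G. c t * z t) = (\<Sum>t\<in>F \<union> G. d t * z t)"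
        using H.kernel_comb_add[OF F(1) G(1), of b a c] by blast
      then have "(\<lambda>t. f t + a * g t, x + a * y) = (H.kernel_comb (F \<union> G) d, \<Sum>t\<in>F \<union> G. d t * h t)"
        using F G by simp
      then show ?thesis using F(1) G(1) unfolding R_def by blast
    qed
    show "f \<in> vcarrier H" if "(f, x) \<in> R" for f x
      using that by (auto simp: R_def H.kernel_comb_closed)
    show "\<bar>x\<bar> \<le> ?c * vnorm H f" if fx: "(f, x) \<in> R" for f x
    proof -
      obtain F b where F: "finite F" "f = H.kernel_comb F b" "x = (\<Sum>t\<in>F. b t * h t)"
        using R_cases[OF fx] by blast
      have "\<bar>x\<bar> \<le> vnorm HX h * std_dev F b" using X_functional_le[OF h F(1)] F(3) by simp
      also have "\<dots> \<le> vnorm HX h * (r / q * vnorm H f)"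
        unfolding F(2) by (intro mult_left_mono std_dev_le F(1) X.norm_nonneg h)
      finally show ?thesis by (simp add: mult_ac)
    qed
  qed (use c in auto)
  have "v = h"
  proof
    fix t
    have "(H.kernel_comb {t} (\<lambda>_. 1), \<Sum>s\<in>{t}. 1 * h s) \<in> R" unfolding R_def by blast
    from v(2)[OF this] show "v t = h t" using v(1) by (simp add: H.inner_kernel_comb)
  qed
  then show "h \<in> vcarrier H" "vnorm H h \<le> ?c" using v by auto
qed

lemma bounded_functional_inner:
  assumes f: "f \<in> vcarrier H"
  shows "bounded_functional HX (\<lambda>h. vinner H h f)"
  unfolding bounded_functional_def
proof (intro conjI ballI allI exI)
  fix h assume h: "h \<in> vcarrier HX"
  have "\<bar>vinner H h f\<bar> \<le> vnorm H h * vnorm H f"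
    by (rule H.cauchy_schwarz[OF X_subset_H(1)[OF h] f])
  also have "\<dots> \<le> r / q * vnorm HX h * vnorm H f"
    by (intro mult_right_mono X_subset_H(2) h H.norm_nonneg f)
  finally show "\<bar>vinner H h f\<bar> \<le> (r / q * vnorm H f) * vnorm HX h" by (simp add: mult_ac)
qed (use f in \<open>simp_all add: X.add_pointwise X.scale_pointwise X_subset_H H.inner_add_fun
  H.inner_scale_fun\<close>)

definition hs_bound :: real where
  "hs_bound = 2 * (2 * (4 * r\<^sup>2) + 8 * (4 * (r / q)\<^sup>2) / q) + 2 * (r / q)\<^sup>2"

text \<open>The Hilbert-Schmidt bound for the embedding of \<open>HX\<close> into \<open>H\<close>. The inner product of a path with \<open>f j\<close>
  need not be one of the Gaussian variables \<open>\<Sum>t\<in>F. a t * Y t\<close>. Therefore the system \<open>f\<close> is replaced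
  by close combinations \<open>g\<close> of kernel sections. These are no longer orthonormal, but they still satisfy
  \<open>\<parallel>\<Sum>j. c\<^sub>j g\<^sub>j\<parallel> \<le> 2 \<parallel>c\<parallel>\<close>, which is all that the trace bound requires: it bounds the operator norm
  of the covariance matrix and, by duality, the sum of squares on \<open>A\<close>. The members of \<open>f\<close> may be
  shorter than unit vectors, so that sequences can be padded with zeros.\<close>

lemma sum_dual_norm_sq_le:
  assumes J: "finite J" and f: "\<And>j. j \<in> J \<Longrightarrow> f j \<in> vcarrier H"
    and orth: "\<And>i j. i \<in> J \<Longrightarrow> j \<in> J \<Longrightarrow> i \<noteq> j \<Longrightarrow> vinner H (f i) (f j) = 0"
    and unit: "\<And>j. j \<in> J \<Longrightarrow> vinner H (f j) (f j) \<le> 1"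
  shows "(\<Sum>j\<in>J. (dual_norm HX (\<lambda>h. vinner H h (f j)))\<^sup>2) \<le> hs_bound"
proof -
  define n where "n = real (card J)"
  \<comment> \<open>With this accuracy the approximation errors of the whole system add up to at most \<open>1\<close>.\<close>
  define \<delta> where "\<delta> = 1 / (n + 1)"
  have n: "0 \<le> n" by (simp add: n_def)
  have \<delta>: "0 < \<delta>" "\<delta> \<le> 1" "n * \<delta> \<le> 1" using n by (auto simp: \<delta>_def field_simps)
  have "\<exists>F a. finite F \<and> vnorm H (\<lambda>t. H.kernel_comb F a t - f j t) < \<delta>" if "j \<in> J" for j
    using H.kernel_comb_dense[OF f[OF that] \<delta>(1)] by blast
  then obtain F0 a0 where approx0: "\<And>j. j \<in> J \<Longrightarrow> finite (F0 j) \<and>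
      vnorm H (\<lambda>t. H.kernel_comb (F0 j) (a0 j) t - f j t) < \<delta>"
    by metis
  define F where "F = (\<Union>j\<in>J. F0 j)"
  define a where "a j t = (if t \<in> F0 j then a0 j t else 0)" for j t
  define g where "g j = H.kernel_comb F (a j)" for j
  define G where "G j \<omega> = (\<Sum>t\<in>F. a j t * Y t \<omega>)" for j \<omega>
  have F: "finite F" using J approx0 by (auto simp: F_def)
  have g: "g j \<in> vcarrier H" for j by (simp add: g_def H.kernel_comb_closed)
  have approx: "vnorm H (\<lambda>t. g j t - f j t) \<le> \<delta>" if "j \<in> J" for j
  proof -
    have "H.kernel_comb F (a j) = H.kernel_comb (F0 j) (a0 j)"
      using that F unfolding H.kernel_comb_def a_def
      by (intro ext sum_restrict_to_subset) (auto simp: F_def)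
    then show ?thesis using approx0[OF that] by (simp add: g_def)
  qed
  have comb: "(\<lambda>t. \<Sum>j\<in>J. c j * g j t) = H.kernel_comb F (\<lambda>t. \<Sum>j\<in>J. c j * a j t)" for c
    unfolding g_def H.kernel_comb_def
    by (simp add: sum_comb_swap)
  have combG: "(\<Sum>j\<in>J. c j * G j \<omega>) = (\<Sum>t\<in>F. (\<Sum>j\<in>J. c j * a j t) * Y t \<omega>)" for c \<omega>
    unfolding G_def by (rule sum_comb_swap)
  have comb_norm: "vnorm H (\<lambda>t. \<Sum>j\<in>J. c j * g j t) \<le> 2 * sqrt (\<Sum>j\<in>J. (c j)\<^sup>2)" for c
  proof -
    define S where "S = sqrt (\<Sum>j\<in>J. (c j)\<^sup>2)"
    have S: "0 \<le> S" by (simp add: S_def sum_nonneg)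
    have cS: "\<bar>c j\<bar> \<le> S" if "j \<in> J" for j
    proof -
      have "(c j)\<^sup>2 \<le> (\<Sum>j\<in>J. (c j)\<^sup>2)" by (rule member_le_sum[OF that]) (auto simp: J)
      then have "sqrt ((c j)\<^sup>2) \<le> S" unfolding S_def by (rule real_sqrt_le_mono)
      then show ?thesis by simp
    qed
    let ?u = "\<lambda>t. \<Sum>j\<in>J. c j * f j t" and ?d = "\<lambda>t. \<Sum>j\<in>J. c j * (g j t - f j t)"
    have u: "?u \<in> vcarrier H" using f by (intro H.sum_fun_closed) auto
    have d: "?d \<in> vcarrier H"
      using H.sum_fun_closed[of J "\<lambda>j t. g j t - f j t" c] H.diff_fun_closed[OF g f] by simp
    have "vnorm H ?u \<le> S"
      unfolding S_def by (rule H.norm_orthogonal_comb_le[OF J f orth unit])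
    moreover have "vnorm H ?d \<le> S"
    proof -
      have "vnorm H ?d \<le> (\<Sum>j\<in>J. \<bar>c j\<bar> * vnorm H (\<lambda>t. g j t - f j t))"
        using H.norm_sum_le[of J "\<lambda>j t. g j t - f j t" c] H.diff_fun_closed[OF g f] by simp
      also have "\<dots> \<le> (\<Sum>j\<in>J. S * \<delta>)"
        using cS approx S H.norm_nonneg[OF H.diff_fun_closed[OF g f]]
        by (intro sum_mono mult_mono) auto
      also have "\<dots> = S * (n * \<delta>)" by (simp add: n_def)
      also have "\<dots> \<le> S" using mult_left_mono[OF \<delta>(3) S] by simp
      finally show ?thesis .
    qed
    moreover have "(\<lambda>t. \<Sum>j\<in>J. c j * g j t) = (\<lambda>t. ?u t + ?d t)"
      by (simp add: algebra_simps flip: sum.distrib)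
    ultimately show ?thesis using H.norm_triangle[OF u d] by (simp add: S_def)
  qed
  have trace: "(\<Sum>j\<in>J. expectation (\<lambda>\<omega>. (G j \<omega>)\<^sup>2)) \<le> 2 * (4 * r\<^sup>2) + 8 * (4 * (r / q)\<^sup>2) / q"
  proof (rule gaussian_trace_bound[OF J])
    fix c
    show "centered_gaussian_var M (\<lambda>\<omega>. \<Sum>j\<in>J. c j * G j \<omega>)"
      unfolding combG by (rule gaussian[OF F])
    have "expectation (\<lambda>\<omega>. (\<Sum>j\<in>J. c j * G j \<omega>)\<^sup>2) = (std_dev F (\<lambda>t. \<Sum>j\<in>J. c j * a j t))\<^sup>2"
      unfolding combG std_dev_sq ..
    also have "\<dots> \<le> (r / q * (2 * sqrt (\<Sum>j\<in>J. (c j)\<^sup>2)))\<^sup>2"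
    proof (rule power_mono[OF _ std_dev_nonneg])
      have "std_dev F (\<lambda>t. \<Sum>j\<in>J. c j * a j t) \<le> r / q * vnorm H (\<lambda>t. \<Sum>j\<in>J. c j * g j t)"
        unfolding comb by (rule std_dev_le[OF F])
      also have "\<dots> \<le> r / q * (2 * sqrt (\<Sum>j\<in>J. (c j)\<^sup>2))"
        using pos by (intro mult_left_mono comb_norm) auto
      finally show "std_dev F (\<lambda>t. \<Sum>j\<in>J. c j * a j t) \<le> r / q * (2 * sqrt (\<Sum>j\<in>J. (c j)\<^sup>2))" .
    qed
    also have "\<dots> = 4 * (r / q)\<^sup>2 * (\<Sum>j\<in>J. (c j)\<^sup>2)"
      by (simp add: power_mult_distrib power_divide sum_nonneg)
    finally show "expectation (\<lambda>\<omega>. (\<Sum>j\<in>J. c j * G j \<omega>)\<^sup>2) \<le> 4 * (r / q)\<^sup>2 * (\<Sum>j\<in>J. (c j)\<^sup>2)" .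
  next
    have [measurable]: "G j \<in> borel_measurable M" for j
      using gaussian[OF F, of "a j"] unfolding G_def centered_gaussian_var_def by blast
    show "q \<le> prob {\<omega> \<in> space M. (\<Sum>j\<in>J. (G j \<omega>)\<^sup>2) \<le> 4 * r\<^sup>2}"
    proof (rule outer)
      show "A \<subseteq> {\<omega> \<in> space M. (\<Sum>j\<in>J. (G j \<omega>)\<^sup>2) \<le> 4 * r\<^sup>2}"
      proof safe
        fix \<omega> assume \<omega>: "\<omega> \<in> A"
        show "\<omega> \<in> space M" using \<omega> A_space by blast
        have "(\<Sum>j\<in>J. (G j \<omega>)\<^sup>2) = (\<Sum>j\<in>J. (vinner H (\<lambda>t. Y t \<omega>) (g j))\<^sup>2)"
          by (simp add: G_def g_def path_inner_kernel_comb[OF \<omega>])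
        also have "\<dots> \<le> 2\<^sup>2 * (vnorm H (\<lambda>t. Y t \<omega>))\<^sup>2"
          using paths[OF \<omega>] by (intro H.dual_of_coefficient_bound J g comb_norm) auto
        also have "\<dots> \<le> 2\<^sup>2 * r\<^sup>2"
          using paths[OF \<omega>] by (intro mult_left_mono power_mono H.norm_nonneg) auto
        finally show "(\<Sum>j\<in>J. (G j \<omega>)\<^sup>2) \<le> 4 * r\<^sup>2" by simp
      qed
    qed simp
  qed (use pos in auto)
  have dn: "(dual_norm HX (\<lambda>h. vinner H h (f j)))\<^sup>2 \<le>
      2 * expectation (\<lambda>\<omega>. (G j \<omega>)\<^sup>2) + 2 * (r / q)\<^sup>2 * \<delta>" if j: "j \<in> J" for j
  proof -
    let ?s = "std_dev F (a j)"
    have "dual_norm HX (\<lambda>h. vinner H h (f j)) \<le> ?s + r / q * \<delta>"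
    proof (rule dual_norm_le[OF X.rkhs_axioms])
      fix h assume h: "h \<in> vcarrier HX"
      note hH = X_subset_H[OF h]
      have "vinner H h (f j) = vinner H h (g j) - vinner H h (\<lambda>t. g j t - f j t)"
        using H.inner_diff_fun_right[OF g f[OF j] hH(1)] by simp
      moreover have "\<bar>vinner H h (g j)\<bar> \<le> vnorm HX h * ?s"
        using X_functional_le[OF h F, of "a j"] hH by (simp add: g_def H.inner_kernel_comb)
      moreover have "\<bar>vinner H h (\<lambda>t. g j t - f j t)\<bar> \<le> (r / q * vnorm HX h) * \<delta>"
        using pos X.norm_nonneg[OF h]
        by (intro order_trans[OF H.cauchy_schwarz[OF hH(1) H.diff_fun_closed[OF g f[OF j]]]]
          mult_mono hH approx j H.norm_nonneg H.diff_fun_closed g f) auto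
      ultimately have "\<bar>vinner H h (f j)\<bar> \<le> vnorm HX h * ?s + (r / q * vnorm HX h) * \<delta>"
        by linarith
      also have "\<dots> = (?s + r / q * \<delta>) * vnorm HX h" by (simp add: algebra_simps)
      finally show "\<bar>vinner H h (f j)\<bar> \<le> (?s + r / q * \<delta>) * vnorm HX h" .
    qed (use pos \<delta> in \<open>simp add: std_dev_nonneg\<close>)
    then have "(dual_norm HX (\<lambda>h. vinner H h (f j)))\<^sup>2 \<le> (?s + r / q * \<delta>)\<^sup>2"
      by (intro power_mono dual_norm_nonneg[OF X.rkhs_axioms] bounded_functional_inner f j)
    also have "\<dots> \<le> 2 * ?s\<^sup>2 + 2 * (r / q * \<delta>)\<^sup>2"
      using zero_le_power2[of "?s - r / q * \<delta>"] unfolding power2_sum power2_diff by linarith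
    also have "(r / q * \<delta>)\<^sup>2 \<le> (r / q)\<^sup>2 * \<delta>"
      using \<delta> unfolding power_mult_distrib
      by (intro mult_left_mono) (simp_all add: power2_eq_square mult_left_le)
    finally show ?thesis by (simp add: std_dev_sq G_def)
  qed
  have "(\<Sum>j\<in>J. (dual_norm HX (\<lambda>h. vinner H h (f j)))\<^sup>2) \<le>
      (\<Sum>j\<in>J. 2 * expectation (\<lambda>\<omega>. (G j \<omega>)\<^sup>2) + 2 * (r / q)\<^sup>2 * \<delta>)"
    by (rule sum_mono) (rule dn)
  also have "\<dots> = 2 * (\<Sum>j\<in>J. expectation (\<lambda>\<omega>. (G j \<omega>)\<^sup>2)) + 2 * (r / q)\<^sup>2 * (n * \<delta>)"
    by (simp add: sum.distrib sum_distrib_left n_def)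
  also have "\<dots> \<le> hs_bound"
    using trace mult_left_mono[OF \<delta>(3), of "2 * (r / q)\<^sup>2"] unfolding hs_bound_def by simp
  finally show ?thesis .
qed

end

context gaussian_paths
begin

text \<open>A maximal orthonormal set of the closure of \<open>HX\<close> in \<open>H\<close> is countable: no member is orthogonal to
  \<open>HX\<close>, so every member contributes a positive amount to the bounded sum of squared dual norms. The
  enumeration is padded with zeros when the set is finite.\<close>

lemma obtain_expansion_system:
  obtains e :: "nat \<Rightarrow> 't \<Rightarrow> real"
  where "\<And>n. e n \<in> H.closed_span (vcarrier HX)"
    "\<And>i j. i \<noteq> j \<Longrightarrow> vinner H (e i) (e j) = 0"
    "\<And>n. vinner H (e n) (e n) = 1 \<or> e n = (\<lambda>t. 0)"
    "\<And>f. f \<in> H.closed_span (vcarrier HX) \<Longrightarrow> (\<And>n. vinner H f (e n) = 0) \<Longrightarrow> f = (\<lambda>t. 0)"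
    "summable (\<lambda>n. (dual_norm HX (\<lambda>h. vinner H h (e n)))\<^sup>2)"
proof -
  let ?S = "H.closed_span (vcarrier HX)"
  define d where "d f = (dual_norm HX (\<lambda>h. vinner H h f))\<^sup>2" for f
  obtain E where E: "E \<subseteq> ?S"
    and orth: "\<And>f g. f \<in> E \<Longrightarrow> g \<in> E \<Longrightarrow> vinner H f g = (if f = g then 1 else 0)"
    and complete: "\<And>f. f \<in> ?S \<Longrightarrow> \<forall>e\<in>E. vinner H f e = 0 \<Longrightarrow> f = (\<lambda>t. 0)"
    using H.complete_orthonormal_subset[of "vcarrier HX"] by blast
  have E_H: "f \<in> vcarrier H" if "f \<in> E" for f
    by (rule H.closed_span_closed[of f "vcarrier HX"]) (use that E in blast)
  have "d summable_on E"
  proof (rule nonneg_bdd_above_summable_on)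
    show "bdd_above (sum d ` {F. F \<subseteq> E \<and> finite F})"
    proof (rule bdd_aboveI2)
      fix F assume "F \<in> {F. F \<subseteq> E \<and> finite F}"
      then show "sum d F \<le> hs_bound"
        unfolding d_def using E_H orth
        by (intro sum_dual_norm_sq_le) (auto simp: subset_eq)
    qed
  qed (simp add: d_def)
  then have "countable {f \<in> E. d f \<noteq> 0}" by (rule summable_countable_real)
  moreover have "d f \<noteq> 0" if "f \<in> E" for f
  proof
    assume "d f = 0"
    have fS: "f \<in> ?S" using that E by blast
    have "vinner H h f = 0" if "h \<in> vcarrier HX" for h
      using \<open>d f = 0\<close> dual_norm_eq_zeroD[OF X.rkhs_axioms
        bounded_functional_inner[OF H.closed_span_closed[OF fS]] _ that]
      by (simp add: d_def)
    then have "f = (\<lambda>t. 0)" by (rule H.closed_span_nondegenerate[OF fS])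
    then show False using orth[OF that that] H.inner_zero_fun[OF H.zero_fun_closed] by simp
  qed
  ultimately have countable: "countable E"
    by (metis (mono_tags, lifting) Collect_mem_eq Collect_cong)
  define I where "I = to_nat_on E ` E"
  define e where "e n = (if n \<in> I then from_nat_into E n else (\<lambda>t. 0))" for n
  have e_I: "e n \<in> E" if "n \<in> I" for n
    using that countable by (auto simp: e_def I_def)
  have e_inj: "i = j" if "i \<in> I" "j \<in> I" "e i = e j" for i j
    using that countable by (auto simp: e_def I_def)
  have e_onto: "\<exists>n. e n = f" if "f \<in> E" for f
    using that countable by (intro exI[of _ "to_nat_on E f"]) (simp add: e_def I_def)
  have e_zero: "e n = (\<lambda>t. 0)" if "n \<notin> I" for n using that by (simp add: e_def)
  have eS: "e n \<in> ?S" for n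
    using e_I E H.zero_closed_span e_zero by (cases "n \<in> I") auto
  have eH: "e n \<in> vcarrier H" for n by (rule H.closed_span_closed[OF eS])
  have e_orth: "vinner H (e i) (e j) = 0" if "i \<noteq> j" for i j
  proof (cases "i \<in> I \<and> j \<in> I")
    case True
    then show ?thesis using orth[OF e_I e_I, of i j] e_inj[of i j] that by auto
  next
    case False
    then show ?thesis
      using H.inner_zero_fun[OF eH] H.inner_commute[OF eH H.zero_fun_closed] e_zero by metis
  qed
  have e_unit: "vinner H (e n) (e n) = 1 \<or> e n = (\<lambda>t. 0)" for n
    using orth[OF e_I e_I, of n n] e_zero[of n] by auto
  have "vinner H (e n) (e n) \<le> 1" for n
    using e_unit[of n] H.inner_zero_fun[OF H.zero_fun_closed] by auto
  then have "summable (\<lambda>n. d (e n))"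
    using e_orth eH
    by (intro summableI_nonneg_bounded[where x = hs_bound]) (simp_all add: d_def sum_dual_norm_sq_le)
  then have e_summable: "summable (\<lambda>n. (dual_norm HX (\<lambda>h. vinner H h (e n)))\<^sup>2)"
    by (simp add: d_def)
  have e_complete: "f = (\<lambda>t. 0)" if "f \<in> ?S" "\<And>n. vinner H f (e n) = 0" for f
    using complete[OF that(1)] that(2) e_onto by metis
  show thesis
    by (rule that[OF eS e_orth e_unit e_complete e_summable])
qed

end

section \<open>Square integrable functions modulo null sets\<close>

lemma L2_fun_measurable: "f \<in> L2_fun \<nu> \<Longrightarrow> f \<in> borel_measurable \<nu>"
  by (simp add: L2_fun_def)

lemma L2_fun_zero: "(\<lambda>t. 0) \<in> L2_fun \<nu>"
  by (simp add: L2_fun_def)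

lemma L2_fun_scale: "f \<in> L2_fun \<nu> \<Longrightarrow> (\<lambda>t. a * f t) \<in> L2_fun \<nu>"
  by (auto simp: L2_fun_def power_mult_distrib)

lemma L2_fun_dominated:
  assumes "g \<in> L2_fun \<nu>" "f \<in> borel_measurable \<nu>" "\<And>t. \<bar>f t\<bar> \<le> c * g t"
  shows "f \<in> L2_fun \<nu>" "(LINT t|\<nu>. (f t)\<^sup>2) \<le> c\<^sup>2 * (LINT t|\<nu>. (g t)\<^sup>2)"
proof -
  have [measurable]: "f \<in> borel_measurable \<nu>" by fact
  have g: "integrable \<nu> (\<lambda>t. c\<^sup>2 * (g t)\<^sup>2)" using assms(1) by (simp add: L2_fun_def)
  have le: "(f t)\<^sup>2 \<le> c\<^sup>2 * (g t)\<^sup>2" for t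
    using power_mono[OF assms(3)[of t], of 2] by (simp add: power_mult_distrib)
  have f: "integrable \<nu> (\<lambda>t. (f t)\<^sup>2)"
    by (rule Bochner_Integration.integrable_bound[OF g]) (use le in auto)
  then show "f \<in> L2_fun \<nu>" using assms(2) by (simp add: L2_fun_def)
  have "(LINT t|\<nu>. (f t)\<^sup>2) \<le> (LINT t|\<nu>. c\<^sup>2 * (g t)\<^sup>2)"
    by (rule integral_mono[OF f g]) (rule le)
  then show "(LINT t|\<nu>. (f t)\<^sup>2) \<le> c\<^sup>2 * (LINT t|\<nu>. (g t)\<^sup>2)" by simp
qed

lemma L2_fun_add:
  assumes "f \<in> L2_fun \<nu>" "g \<in> L2_fun \<nu>"
  shows "(\<lambda>t. f t + g t) \<in> L2_fun \<nu>"
proof -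
  have [measurable]: "f \<in> borel_measurable \<nu>" "g \<in> borel_measurable \<nu>"
    using assms by (auto simp: L2_fun_def)
  have "integrable \<nu> (\<lambda>t. (f t + g t)\<^sup>2)"
  proof (rule Bochner_Integration.integrable_bound)
    show "integrable \<nu> (\<lambda>t. 2 * (f t)\<^sup>2 + 2 * (g t)\<^sup>2)" using assms by (simp add: L2_fun_def)
    have "(x + y)\<^sup>2 \<le> 2 * x\<^sup>2 + 2 * y\<^sup>2" for x y :: real
      using zero_le_power2[of "x - y"] unfolding power2_sum power2_diff by linarith
    then show "AE t in \<nu>. norm ((f t + g t)\<^sup>2) \<le> norm (2 * (f t)\<^sup>2 + 2 * (g t)\<^sup>2)" by simp
  qed simp
  then show ?thesis by (simp add: L2_fun_def)
qed

lemma L2_fun_sum: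
  assumes "\<And>i. i \<in> I \<Longrightarrow> f i \<in> L2_fun \<nu>"
  shows "(\<lambda>t. \<Sum>i\<in>I. f i t) \<in> L2_fun \<nu>"
  using assms
  by (induction I rule: infinite_finite_induct) (simp_all add: L2_fun_zero L2_fun_add)

lemma L2_class_eqI:
  assumes "f \<in> L2_fun \<nu>" "g \<in> L2_fun \<nu>" "AE t in \<nu>. f t = g t"
  shows "L2_class \<nu> f = L2_class \<nu> g"
proof -
  have "(AE t in \<nu>. f t = h t) \<longleftrightarrow> (AE t in \<nu>. g t = h t)" for h
  proof
    assume "AE t in \<nu>. f t = h t"
    then show "AE t in \<nu>. g t = h t" using assms(3) by eventually_elim simp
  next
    assume "AE t in \<nu>. g t = h t"
    then show "AE t in \<nu>. f t = h t" using assms(3) by eventually_elim simp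
  qed
  then show ?thesis using assms(1,2) by (auto simp: L2_class_def L2_rel_def)
qed

lemma L2_rep_class:
  assumes "f \<in> L2_fun \<nu>"
  shows "L2_rep (L2_class \<nu> f) \<in> L2_fun \<nu>" "AE t in \<nu>. L2_rep (L2_class \<nu> f) t = f t"
proof -
  have "f \<in> L2_class \<nu> f" using assms by (simp add: L2_class_def L2_rel_def)
  then have "L2_rep (L2_class \<nu> f) \<in> L2_class \<nu> f" unfolding L2_rep_def some_in_eq by blast
  moreover have "g \<in> L2_fun \<nu> \<and> (AE t in \<nu>. f t = g t)" if "g \<in> L2_class \<nu> f" for g
    using that by (simp add: L2_class_def L2_rel_def)
  ultimately have "L2_rep (L2_class \<nu> f) \<in> L2_fun \<nu> \<and> (AE t in \<nu>. f t = L2_rep (L2_class \<nu> f) t)"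
    by blast
  then show "L2_rep (L2_class \<nu> f) \<in> L2_fun \<nu>" "AE t in \<nu>. L2_rep (L2_class \<nu> f) t = f t"
    by (auto elim: eventually_mono)
qed

lemma L2_class_carrier: "f \<in> L2_fun \<nu> \<Longrightarrow> L2_class \<nu> f \<in> vcarrier (L2_space \<nu>)"
  by (simp add: L2_space_def L2_class_def quotientI)

lemma L2_zero_class: "vzero (L2_space \<nu>) = L2_class \<nu> (\<lambda>t. 0)"
  by (simp add: L2_space_def)

lemma L2_add_class:
  assumes f: "f \<in> L2_fun \<nu>" and g: "g \<in> L2_fun \<nu>"
  shows "vadd (L2_space \<nu>) (L2_class \<nu> f) (L2_class \<nu> g) = L2_class \<nu> (\<lambda>t. f t + g t)"
proof -
  have "AE t in \<nu>. L2_rep (L2_class \<nu> f) t + L2_rep (L2_class \<nu> g) t = f t + g t"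
    using L2_rep_class(2)[OF f] L2_rep_class(2)[OF g] by eventually_elim simp
  then have "L2_class \<nu> (\<lambda>t. L2_rep (L2_class \<nu> f) t + L2_rep (L2_class \<nu> g) t) =
      L2_class \<nu> (\<lambda>t. f t + g t)"
    by (intro L2_class_eqI L2_fun_add L2_rep_class(1) f g)
  then show ?thesis by (simp add: L2_space_def)
qed

lemma L2_scale_class:
  assumes f: "f \<in> L2_fun \<nu>"
  shows "vscale (L2_space \<nu>) a (L2_class \<nu> f) = L2_class \<nu> (\<lambda>t. a * f t)"
proof -
  have "AE t in \<nu>. a * L2_rep (L2_class \<nu> f) t = a * f t"
    using L2_rep_class(2)[OF f] by eventually_elim simp
  then have "L2_class \<nu> (\<lambda>t. a * L2_rep (L2_class \<nu> f) t) = L2_class \<nu> (\<lambda>t. a * f t)"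
    by (intro L2_class_eqI L2_fun_scale L2_rep_class(1) f)
  then show ?thesis by (simp add: L2_space_def)
qed

lemma L2_diff_class:
  assumes "f \<in> L2_fun \<nu>" "g \<in> L2_fun \<nu>"
  shows "vdiff (L2_space \<nu>) (L2_class \<nu> f) (L2_class \<nu> g) = L2_class \<nu> (\<lambda>t. f t - g t)"
  using L2_add_class[OF assms(1) L2_fun_scale[OF assms(2), of "-1"]]
  by (simp add: vdiff_def L2_scale_class assms)

lemma L2_partial_sum_class:
  assumes "\<And>i. f i \<in> L2_fun \<nu>"
  shows "vpartial_sum (L2_space \<nu>) (\<lambda>i. L2_class \<nu> (f i)) n = L2_class \<nu> (\<lambda>t. \<Sum>i<n. f i t)"
  by (induction n) (simp_all add: L2_zero_class L2_add_class L2_fun_sum assms)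

lemma L2_norm_class:
  assumes f: "f \<in> L2_fun \<nu>"
  shows "vnorm (L2_space \<nu>) (L2_class \<nu> f) = sqrt (LINT t|\<nu>. (f t)\<^sup>2)"
proof -
  let ?r = "L2_rep (L2_class \<nu> f)"
  have [measurable]: "f \<in> borel_measurable \<nu>" "?r \<in> borel_measurable \<nu>"
    using f L2_rep_class(1)[OF f] by (auto intro: L2_fun_measurable)
  have "AE t in \<nu>. ?r t * ?r t = (f t)\<^sup>2"
    using L2_rep_class(2)[OF f] by eventually_elim (simp add: power2_eq_square)
  then have "(LINT t|\<nu>. ?r t * ?r t) = (LINT t|\<nu>. (f t)\<^sup>2)" by (intro integral_cong_AE) auto
  then show ?thesis by (simp add: vnorm_def L2_space_def)
qed

section \<open>Nuclearity of the embedding\<close>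

context gaussian_paths
begin

text \<open>Functions of \<open>H\<close> need not be measurable, but those in the closure of \<open>HX\<close> are, since convergence in
  \<open>H\<close> implies pointwise convergence.\<close>

lemma measurable_closed_span:
  assumes meas: "vcarrier HX \<subseteq> borel_measurable \<nu>"
    and f: "f \<in> H.closed_span (vcarrier HX)"
  shows "f \<in> borel_measurable \<nu>"
proof -
  have sub: "vcarrier HX \<subseteq> vcarrier H" using X_subset_H by blast
  obtain x where x: "\<And>n. x n \<in> vcarrier HX" "(\<lambda>n. vnorm H (\<lambda>t. x n t - f t)) \<longlonglongrightarrow> 0"
    by (rule H.closed_span_approx[OF sub X.zero_fun_closed _ f])
      (auto intro: X.add_fun_closed X.scale_fun_closed)
  show ?thesis
  proof (rule borel_measurable_LIMSEQ_real)
    show "x n \<in> borel_measurable \<nu>" for n using x(1) meas by blast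
    show "(\<lambda>n. x n t) \<longlonglongrightarrow> f t" for t
      by (rule H.converges_pointwise[OF _ H.closed_span_closed[OF f] x(2)]) (use x(1) sub in blast)
  qed
qed

text \<open>The expansion of \<open>h\<close> along the system \<open>e\<close> is the nuclear representation. The products of dual norms and
  \<open>L\<^sub>2(\<nu>)\<close> norms are summable because both factors are square summable.\<close>

lemma embedding_nuclear:
  assumes meas: "vcarrier HX \<subseteq> borel_measurable \<nu>"
    and b: "envelope H b" "b \<in> L2_fun \<nu>"
  shows "\<forall>h\<in>vcarrier HX. h \<in> L2_fun \<nu>"
    and "nuclear_operator HX (L2_space \<nu>) (L2_class \<nu>)"
proof -
  let ?S = "H.closed_span (vcarrier HX)" and ?W = "L2_space \<nu>"
  define B where "B = (LINT t|\<nu>. (b t)\<^sup>2)"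
  have XS: "h \<in> ?S" if "h \<in> vcarrier HX" for h
    using H.subset_closed_span[of "vcarrier HX"] X_subset_H(1) that by blast
  have L2: "f \<in> L2_fun \<nu>" "(LINT t|\<nu>. (f t)\<^sup>2) \<le> (vnorm H f)\<^sup>2 * B" if f: "f \<in> ?S" for f
  proof -
    have "\<bar>f t\<bar> \<le> vnorm H f * b t" for t
      using b(1) H.closed_span_closed[OF f] by (simp add: envelope_def)
    from L2_fun_dominated[OF b(2) measurable_closed_span[OF meas f] this]
    show "f \<in> L2_fun \<nu>" "(LINT t|\<nu>. (f t)\<^sup>2) \<le> (vnorm H f)\<^sup>2 * B"
      by (simp_all add: B_def)
  qed
  show X_L2: "\<forall>h\<in>vcarrier HX. h \<in> L2_fun \<nu>" using L2(1) XS by blast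
  obtain e :: "nat \<Rightarrow> 't \<Rightarrow> real" where e: "\<And>n. e n \<in> ?S"
    and orth: "\<And>i j. i \<noteq> j \<Longrightarrow> vinner H (e i) (e j) = 0"
    and unit: "\<And>n. vinner H (e n) (e n) = 1 \<or> e n = (\<lambda>t. 0)"
    and complete: "\<And>f. f \<in> ?S \<Longrightarrow> (\<And>n. vinner H f (e n) = 0) \<Longrightarrow> f = (\<lambda>t. 0)"
    and summable_dual: "summable (\<lambda>n. (dual_norm HX (\<lambda>h. vinner H h (e n)))\<^sup>2)"
    using obtain_expansion_system by blast
  have eH: "e n \<in> vcarrier H" for n by (rule H.closed_span_closed[OF e])
  have unit': "vinner H (e n) (e n) \<le> 1" for n
    using unit[of n] H.inner_zero_fun[OF H.zero_fun_closed] by auto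
  define \<phi> where "\<phi> n h = vinner H h (e n)" for n h
  define w where "w n = L2_class \<nu> (e n)" for n
  have bounded: "bounded_functional HX (\<phi> n)" for n
    unfolding \<phi>_def by (rule bounded_functional_inner[OF eH])
  have w_sq: "(vnorm ?W (w n))\<^sup>2 = (LINT t|\<nu>. (e n t)\<^sup>2)" for n
    by (simp add: w_def L2_norm_class L2 e)
  have summable_w: "summable (\<lambda>n. (vnorm ?W (w n))\<^sup>2)"
  proof (rule summableI_nonneg_bounded)
    fix n
    have int: "integrable \<nu> (\<lambda>t. (e i t)\<^sup>2)" for i using L2(1)[OF e] by (simp add: L2_fun_def)
    have "(\<Sum>i<n. (vnorm ?W (w i))\<^sup>2) = (LINT t|\<nu>. (\<Sum>i<n. (e i t)\<^sup>2))"
      unfolding w_sq using int by simp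
    also have "\<dots> \<le> B" unfolding B_def
    proof (rule integral_mono)
      show "integrable \<nu> (\<lambda>t. (b t)\<^sup>2)" using b(2) by (simp add: L2_fun_def)
      show "(\<Sum>i<n. (e i t)\<^sup>2) \<le> (b t)\<^sup>2" for t
        by (rule H.envelope_sum_sq_le[OF b(1)]) (auto intro: eH orth unit')
    qed (use int in simp)
    finally show "(\<Sum>i<n. (vnorm ?W (w i))\<^sup>2) \<le> B" .
  qed simp
  have summable: "summable (\<lambda>n. dual_norm HX (\<phi> n) * vnorm ?W (w n))"
  proof (rule summable_comparison_test')
    show "summable (\<lambda>n. (dual_norm HX (\<phi> n))\<^sup>2 + (vnorm ?W (w n))\<^sup>2)"
      unfolding \<phi>_def by (intro summable_add summable_dual summable_w)
    have "\<bar>x * y\<bar> \<le> x\<^sup>2 + y\<^sup>2" for x y :: real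
      using zero_le_power2[of "x + y"] zero_le_power2[of "x - y"] zero_le_power2[of x]
        zero_le_power2[of y] unfolding power2_sum power2_diff by (intro abs_leI) linarith+
    then show "norm (dual_norm HX (\<phi> n) * vnorm ?W (w n)) \<le>
        (dual_norm HX (\<phi> n))\<^sup>2 + (vnorm ?W (w n))\<^sup>2" for n by simp
  qed
  \<comment> \<open>The envelope dominates the \<open>L\<^sub>2(\<nu>)\<close> norm of the error by its norm in \<open>H\<close>.\<close>
  have converges: "vconverges ?W (vpartial_sum ?W (\<lambda>n. vscale ?W (\<phi> n h) (w n))) (L2_class \<nu> h)"
    if h: "h \<in> vcarrier HX" for h
  proof -
    define D where "D n = (\<lambda>t. (\<Sum>i<n. \<phi> i h * e i t) - h t)" for n :: nat
    have sumS: "(\<lambda>t. \<Sum>i<n. \<phi> i h * e i t) \<in> ?S" for n by (intro H.sum_closed_span e)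
    have DS: "D n \<in> ?S" for n unfolding D_def by (rule H.diff_closed_span[OF sumS XS[OF h]])
    have "vpartial_sum ?W (\<lambda>n. vscale ?W (\<phi> n h) (w n)) n = L2_class \<nu> (\<lambda>t. \<Sum>i<n. \<phi> i h * e i t)"
      for n
      by (simp add: w_def L2_scale_class L2(1) e L2_partial_sum_class L2_fun_scale)
    then have err: "vnorm ?W (vdiff ?W (vpartial_sum ?W (\<lambda>n. vscale ?W (\<phi> n h) (w n)) n) (L2_class \<nu> h))
        = sqrt (LINT t|\<nu>. (D n t)\<^sup>2)" for n
      using L2_norm_class[OF L2(1)[OF DS, of n]]
      by (simp add: L2_diff_class L2(1)[OF sumS] L2(1)[OF XS[OF h]] D_def)
    have "(\<lambda>n. vnorm H (D n)) \<longlonglongrightarrow> 0"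
      unfolding D_def \<phi>_def
      by (rule H.orthogonal_expansion[OF e orth unit complete XS[OF h]])
    then have lim: "(\<lambda>n. vnorm H (D n) * sqrt B) \<longlonglongrightarrow> 0"
      using tendsto_mult_right[of _ 0 _ "sqrt B"] by fastforce
    have "sqrt (LINT t|\<nu>. (D n t)\<^sup>2) \<le> vnorm H (D n) * sqrt B" for n
      using real_sqrt_le_mono[OF L2(2)[OF DS, of n]] H.norm_nonneg[OF H.closed_span_closed[OF DS]]
      by (simp add: real_sqrt_mult)
    then have "(\<lambda>n. sqrt (LINT t|\<nu>. (D n t)\<^sup>2)) \<longlonglongrightarrow> 0"
      by (intro Lim_null_comparison[OF _ lim]) simp
    then show ?thesis by (simp add: vconverges_def err)
  qed
  have "linear_operator HX ?W (L2_class \<nu>)"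
    unfolding linear_operator_def using X_L2
    by (simp add: L2_class_carrier L2_add_class L2_scale_class X.add_pointwise X.scale_pointwise)
  moreover have "w n \<in> vcarrier ?W" for n by (simp add: w_def L2_class_carrier L2 e)
  ultimately show "nuclear_operator HX ?W (L2_class \<nu>)"
    unfolding nuclear_operator_def using bounded summable converges by blast
qed

end

lemma (in prob_space) version_comb_gaussian:
  assumes X: "centered_gaussian_process M X" and XY: "version_of M X Y" and F: "finite F"
  shows "centered_gaussian_var M (\<lambda>\<omega>. \<Sum>t\<in>F. a t * Y t \<omega>)"
proof -
  have [measurable]: "X t \<in> borel_measurable M" "Y t \<in> borel_measurable M" for t
    using X XY by (auto simp: centered_gaussian_process_def gaussian_process_def version_of_def)
  have comb: "gaussian_measure (distr M borel (\<lambda>\<omega>. \<Sum>t\<in>F. a t * X t \<omega>))" if "finite F" for F a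
    using X that by (simp add: centered_gaussian_process_def gaussian_process_def)
  have "centered_gaussian_var M (X t)" for t
    using comb[of "{t}" "\<lambda>_. 1"] X by (simp add: centered_gaussian_var_def centered_gaussian_process_def)
  then have int: "integrable M (X t)" for t using integrable_gaussian_power[of "X t" 1] by simp
  have mean: "expectation (X t) = 0" for t using X by (simp add: centered_gaussian_process_def)
  have "AE \<omega> in M. \<forall>t\<in>F. X t \<omega> = Y t \<omega>"
    using XY F by (simp add: version_of_def AE_finite_all)
  then have AE: "AE \<omega> in M. (\<Sum>t\<in>F. a t * X t \<omega>) = (\<Sum>t\<in>F. a t * Y t \<omega>)"
    by eventually_elim (auto intro: sum.cong)
  have "distr M borel (\<lambda>\<omega>. \<Sum>t\<in>F. a t * X t \<omega>) = distr M borel (\<lambda>\<omega>. \<Sum>t\<in>F. a t * Y t \<omega>)"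
    by (rule distr_cong_AE) (use AE in auto)
  moreover have "expectation (\<lambda>\<omega>. \<Sum>t\<in>F. a t * Y t \<omega>) = expectation (\<lambda>\<omega>. \<Sum>t\<in>F. a t * X t \<omega>)"
    by (rule integral_cong_AE) (use AE in \<open>auto elim: eventually_mono\<close>)
  moreover have "\<dots> = 0" using int mean by simp
  ultimately show ?thesis using comb[OF F, of a] by (simp add: centered_gaussian_var_def)
qed

lemma (in prob_space) version_covariance:
  assumes X: "centered_gaussian_process M X" and XY: "version_of M X Y"
  shows "covariance_kernel M X s t = expectation (\<lambda>\<omega>. Y s \<omega> * Y t \<omega>)"
  unfolding covariance_kernel_def
proof (rule integral_cong_AE)
  have meas: "X t \<in> borel_measurable M" "Y t \<in> borel_measurable M" for t
    using X XY by (auto simp: centered_gaussian_process_def gaussian_process_def version_of_def)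
  show "(\<lambda>\<omega>. X s \<omega> * X t \<omega>) \<in> borel_measurable M" "(\<lambda>\<omega>. Y s \<omega> * Y t \<omega>) \<in> borel_measurable M"
    using meas by auto
  have "AE \<omega> in M. X s \<omega> = Y s \<omega>" "AE \<omega> in M. X t \<omega> = Y t \<omega>" using XY by (auto simp: version_of_def)
  then show "AE \<omega> in M. X s \<omega> * X t \<omega> = Y s \<omega> * Y t \<omega>" by eventually_elim simp
qed

text \<open>The sublevel sets of \<open>\<lambda>\<omega>. N (Z \<omega>)\<close> may be non-measurable. Outer measure is continuous along increasing sequences
  of arbitrary sets, hence one of them has positive outer probability.\<close>

lemma (in prob_space) obtain_thick_norm_ball:
  fixes N :: "'b \<Rightarrow> real"
  assumes pos: "prob {\<omega> \<in> space M. Z \<omega> \<in> C} > 0"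
  obtains r q where "0 < r" "0 < q"
    "\<And>E. E \<in> sets M \<Longrightarrow> {\<omega> \<in> space M. Z \<omega> \<in> C \<and> N (Z \<omega>) \<le> r} \<subseteq> E \<Longrightarrow> q \<le> prob E"
proof -
  define A where "A = {\<omega> \<in> space M. Z \<omega> \<in> C}"
  define S where "S n = {\<omega> \<in> space M. Z \<omega> \<in> C \<and> N (Z \<omega>) \<le> real n}" for n
  have "A \<in> sets M" using pos measure_notin_sets unfolding A_def by fastforce
  have "(\<Union>n. S n) = A" using real_arch_simple by (auto simp: S_def A_def)
  moreover have "incseq S" by (auto simp: incseq_def S_def)
  moreover have S_space: "S n \<subseteq> space M" for n by (auto simp: S_def)
  ultimately have "(SUP n. outer_measure_of M (S n)) = emeasure M A"
    using SUP_outer_measure_of_incseq[of S M] \<open>A \<in> sets M\<close> by simp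
  then have "0 < (SUP n. outer_measure_of M (S n))"
    using pos by (simp add: emeasure_eq_measure A_def)
  then obtain n where n: "0 < outer_measure_of M (S n)" by (auto simp: less_SUP_iff)
  obtain E0 where E0: "E0 \<in> sets M" "outer_measure_of M (S n) = emeasure M E0"
    using outer_measure_of_attain[OF S_space] by blast
  show thesis
  proof (rule that)
    show "0 < real n + 1" by simp
    show "0 < prob E0" using n E0 by (simp add: emeasure_eq_measure)
    fix E assume E: "E \<in> sets M" "{\<omega> \<in> space M. Z \<omega> \<in> C \<and> N (Z \<omega>) \<le> real n + 1} \<subseteq> E"
    then have "S n \<subseteq> E" by (auto simp: S_def)
    then have "outer_measure_of M (S n) \<le> emeasure M E"
      using outer_measure_of_mono[of "S n" E M] E(1) by simp
    then show "prob E0 \<le> prob E" using E0 by (simp add: emeasure_eq_measure)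
  qed
qed

theorem theorem3p2:
  fixes M :: "'w measure"
    and X Y :: "'t \<Rightarrow> 'w \<Rightarrow> real"
    and HX H :: "('t \<Rightarrow> real) inner_space"
  assumes "prob_space M"
    and "complete_measure M"
    and "centered_gaussian_process M X"
    and "rkhs_of_kernel HX (covariance_kernel M X)"
    and "rkhs H"
    and "version_of M X Y"
    and "measure M {\<omega> \<in> space M. (\<lambda>t. Y t \<omega>) \<in> vcarrier H} > 0"
  shows "\<forall>(B :: 't set set) (b :: 't \<Rightarrow> real) (\<nu> :: 't measure).
    sigma_algebra UNIV B \<longrightarrow>
    vcarrier HX \<subseteq> borel_measurable (sigma UNIV B) \<longrightarrow>
    b \<in> borel_measurable (sigma UNIV B) \<longrightarrow>
    envelope H b \<longrightarrow>
    sets \<nu> = B \<longrightarrow>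
    b \<in> L2_fun \<nu> \<longrightarrow>
      (\<forall>h\<in>vcarrier HX. h \<in> L2_fun \<nu>) \<and>
      nuclear_operator HX (L2_space \<nu>) (L2_class \<nu>)"
proof -
  interpret prob_space M by fact
  obtain r q where rq: "0 < r" "0 < q"
    and outer: "\<And>E. E \<in> sets M \<Longrightarrow>
      {\<omega> \<in> space M. (\<lambda>t. Y t \<omega>) \<in> vcarrier H \<and> vnorm H (\<lambda>t. Y t \<omega>) \<le> r} \<subseteq> E \<Longrightarrow> q \<le> prob E"
    using obtain_thick_norm_ball[OF assms(7), of "vnorm H"] by blast
  have HX: "rkhs HX" and kernel: "\<And>t. (\<lambda>s. covariance_kernel M X s t) \<in> vcarrier HX"
    and repr: "\<And>h t. h \<in> vcarrier HX \<Longrightarrow> h t = vinner HX h (\<lambda>s. covariance_kernel M X s t)"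
    using assms(4) by (auto simp: rkhs_of_kernel_def)
  note cov = version_covariance[OF assms(3,6)]
  interpret H: rkhs H by fact
  interpret X: rkhs HX by fact
  interpret gaussian_paths H HX M Y
    "{\<omega> \<in> space M. (\<lambda>t. Y t \<omega>) \<in> vcarrier H \<and> vnorm H (\<lambda>t. Y t \<omega>) \<le> r}" r q
  proof
    show "centered_gaussian_var M (\<lambda>\<omega>. \<Sum>t\<in>F. a t * Y t \<omega>)" if "finite F" for F a
      by (rule version_comb_gaussian[OF assms(3,6) that])
    show "(\<lambda>s. expectation (\<lambda>\<omega>. Y s \<omega> * Y t \<omega>)) \<in> vcarrier HX" for t
      using kernel[of t] by (simp add: cov)
    show "vinner HX h (\<lambda>s. expectation (\<lambda>\<omega>. Y s \<omega> * Y t \<omega>)) = h t" if "h \<in> vcarrier HX" for h t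
      using repr[OF that, of t] by (simp add: cov)
    show "q \<le> prob E" if "E \<in> sets M"
      "{\<omega> \<in> space M. (\<lambda>t. Y t \<omega>) \<in> vcarrier H \<and> vnorm H (\<lambda>t. Y t \<omega>) \<le> r} \<subseteq> E" for E
      using outer that by blast
  qed (use rq in auto)
  show ?thesis
  proof (intro allI impI)
    fix B :: "'t set set" and b :: "'t \<Rightarrow> real" and \<nu> :: "'t measure"
    assume B: "sigma_algebra UNIV B" "vcarrier HX \<subseteq> borel_measurable (sigma UNIV B)"
      "b \<in> borel_measurable (sigma UNIV B)" "envelope H b" "sets \<nu> = B" "b \<in> L2_fun \<nu>"
    have "sets (sigma UNIV B) = sets \<nu>"
      using sigma_algebra.sigma_sets_eq[OF B(1)] B(5) by simp
    then have "borel_measurable (sigma UNIV B) = (borel_measurable \<nu> :: ('t \<Rightarrow> real) set)"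
      by (intro measurable_cong_sets) auto
    then have "vcarrier HX \<subseteq> borel_measurable \<nu>" using B(2) by simp
    then show "(\<forall>h\<in>vcarrier HX. h \<in> L2_fun \<nu>) \<and>
        nuclear_operator HX (L2_space \<nu>) (L2_class \<nu>)"
      using embedding_nuclear B(4,6) by blast
  qed
qed

end
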